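(* Let the standing assumptions (see context) hold with $H\in(\tfrac12,1)$ and $\beta\in(1-2H,1]$. Let $X$ be the mild solution of the SPDE and, for $N\in\mathbb N$, let $X^N$ be the mild solution of the spectral Galerkin problem $$X^N(t)=E_N(t)P_N\xi+\int_0^tE_N(t-s)P_NF(X^N(s))\,\mathrm ds+\int_0^tE_N(t-s)P_N\Phi\,\mathrm dW^H(s).$$ Then there is a constant $C$ independent of $N$ and $t$ such that for all $t\in[0,T]$, $$\|X(t)-X^N(t)\|_{L^2(\Omega;V)}\le C\big(1+\|\xi\|_{L^2(\Omega;V_{2H+\beta-1})}\big)\lambda_{N+1}^{-\frac{2H+\beta-1}{2}} .$$
   Context: Standing setting. $(V,\langle\cdot,\cdot\rangle,\|\cdot\|)$ is a real separable Hilbert space, $\mathcal L_2$ the Hilbert–Schmidt operators on $V$. $A$ is a linear, densely defined, positive self-adjoint unbounded operator with compact inverse, orthonormal eigenbasis $(e_i)$, $Ae_i=\lambda_ie_i$, $0<\lambda_1\le\lambda_2\le\dots\to\infty$; $E(t)=e^{-tA}$; $V_\gamma=\mathrm{dom}(A^{\gamma/2})$ with norm $\|A^{\gamma/2}\cdot\|$. $F:V\to V$ satisfies $\|F(u)\|\le L(\|u\|+1)$, $\|F(u)-F(v)\|\le L\|u-v\|$. $W^H(t)=\sum_n w^H_n(t)e_n$ is a cylindrical fBm with independent scalar standard fBms of Hurst index $H\in(\tfrac12,1)$ on a filtered probability space. $\Phi$ is a deterministic linear operator on $V$ with $\|A^{\frac{\beta-1}{2}}\Phi\|_{\mathcal L_2}<\infty$,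 $\beta\in(1-2H,1]$. $\xi$ is $\mathcal F_0$-measurable with $\xi\in L^2(\Omega;V_{2H+\beta-1})$. The mild solution of $\mathrm dX+AX\,\mathrm dt=F(X)\,\mathrm dt+\Phi\,\mathrm dW^H$, $X(0)=\xi$, on $[0,T]$ is $X(t)=E(t)\xi+\int_0^tE(t-s)F(X(s))\,\mathrm ds+\int_0^tE(t-s)\Phi\,\mathrm dW^H(s)$. $P_N$ is the orthogonal projection onto $\mathrm{span}\{e_1,\dots,e_N\}$, $A_N=AP_N$, $E_N(t)=e^{-tA_N}$. Stochastic integrals against $W^H$ of deterministic integrands are Wiener integrals $\sum_n\int\Psi e_n\,\mathrm dw^H_n$. *)

theory Defs
  imports "HOL-Probability.Probability"
begin

section \<open>Spectral data of A (0-based indexing: e 0 = e_1, lam 0 = lambda_1)\<close>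

definition spectral_data :: "(nat \<Rightarrow> 'v::{real_inner,banach}) \<Rightarrow> (nat \<Rightarrow> real) \<Rightarrow> bool" where
  "spectral_data e lam \<longleftrightarrow>
     (\<forall>i j. e i \<bullet> e j = (if i = j then 1 else 0)) \<and>
     (\<forall>x. (\<lambda>i. (x \<bullet> e i) *\<^sub>R e i) sums x) \<and>
     0 < lam 0 \<and> mono lam \<and> filterlim lam at_top sequentially"

definition semigr :: "(nat \<Rightarrow> 'v::{real_inner,banach}) \<Rightarrow> (nat \<Rightarrow> real) \<Rightarrow> real \<Rightarrow> 'v \<Rightarrow> 'v" where
  "semigr e lam t x = (\<Sum>i. (exp (- t * lam i) * (x \<bullet> e i)) *\<^sub>R e i)"

definition proj :: "(nat \<Rightarrow> 'v::{real_inner,banach}) \<Rightarrow> nat \<Rightarrow> 'v \<Rightarrow> 'v" where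
  "proj e N x = (\<Sum>i<N. (x \<bullet> e i) *\<^sub>R e i)"

text \<open>E_N(t) = exp(-t A_N) with A_N = A P_N (identity on the complement of the range of P_N).\<close>
definition semigr_N :: "(nat \<Rightarrow> 'v::{real_inner,banach}) \<Rightarrow> (nat \<Rightarrow> real) \<Rightarrow> nat \<Rightarrow> real \<Rightarrow> 'v \<Rightarrow> 'v" where
  "semigr_N e lam N t x = (\<Sum>i<N. (exp (- t * lam i) * (x \<bullet> e i)) *\<^sub>R e i) + (x - proj e N x)"

text \<open>Squared norm in V_gamma = dom(A^(gamma/2)): sum of lam_i^gamma <x,e_i>^2.\<close>
definition Vnorm_sq :: "(nat \<Rightarrow> 'v::{real_inner,banach}) \<Rightarrow> (nat \<Rightarrow> real) \<Rightarrow> real \<Rightarrow> 'v \<Rightarrow> real" where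
  "Vnorm_sq e lam \<gamma> x = (\<Sum>i. lam i powr \<gamma> * (x \<bullet> e i)\<^sup>2)"

definition gaussian_rv :: "'a measure \<Rightarrow> ('a \<Rightarrow> real) \<Rightarrow> bool" where
  "gaussian_rv M X \<longleftrightarrow> X \<in> borel_measurable M \<and>
     ((\<exists>\<mu>. AE \<omega> in M. X \<omega> = \<mu>) \<or>
      (\<exists>\<mu> \<sigma>. 0 < \<sigma> \<and> distributed M lborel X (\<lambda>x. ennreal (normal_density \<mu> \<sigma> x))))"

definition std_fbm :: "'a measure \<Rightarrow> real \<Rightarrow> (real \<Rightarrow> 'a \<Rightarrow> real) \<Rightarrow> bool" where
  "std_fbm M H b \<longleftrightarrow>
     (\<forall>t\<ge>0. b t \<in> borel_measurable M) \<and>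
     (\<forall>ts cs. length ts = length cs \<longrightarrow> (\<forall>t\<in>set ts. 0 \<le> t) \<longrightarrow>
        gaussian_rv M (\<lambda>\<omega>. \<Sum>i<length ts. cs ! i * b (ts ! i) \<omega>)) \<and>
     (\<forall>t\<ge>0. (\<integral>\<omega>. b t \<omega> \<partial>M) = 0) \<and>
     (\<forall>s\<ge>0. \<forall>t\<ge>0. (\<integral>\<omega>. b s \<omega> * b t \<omega> \<partial>M) =
         (s powr (2*H) + t powr (2*H) - \<bar>t - s\<bar> powr (2*H)) / 2)"

definition riemann_sum :: "(real \<Rightarrow> 'a \<Rightarrow> real) \<Rightarrow> (real \<Rightarrow> 'v::real_normed_vector) \<Rightarrow> real \<Rightarrow> nat \<Rightarrow> 'a \<Rightarrow> 'v" where
  "riemann_sum b g t k \<omega> =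
     (\<Sum>j<k. (b (real (Suc j) * t / real k) \<omega> - b (real j * t / real k) \<omega>) *\<^sub>R g (real j * t / real k))"

definition wiener_int :: "'a measure \<Rightarrow> (real \<Rightarrow> 'a \<Rightarrow> real) \<Rightarrow> (real \<Rightarrow> 'v::{real_normed_vector,second_countable_topology}) \<Rightarrow> real \<Rightarrow> ('a \<Rightarrow> 'v) \<Rightarrow> bool" where
  "wiener_int M b g t Y \<longleftrightarrow> Y \<in> borel_measurable M \<and>
     ((\<lambda>k. \<integral>\<^sup>+ \<omega>. ennreal ((norm (Y \<omega> - riemann_sum b g t k \<omega>))\<^sup>2) \<partial>M) \<longlonglongrightarrow> 0)"

definition stoch_int :: "'a measure \<Rightarrow> (nat \<Rightarrow> 'v::{real_inner,banach,second_countable_topology}) \<Rightarrow>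
     (nat \<Rightarrow> real \<Rightarrow> 'a \<Rightarrow> real) \<Rightarrow> (real \<Rightarrow> 'v \<Rightarrow> 'v) \<Rightarrow> real \<Rightarrow> ('a \<Rightarrow> 'v) \<Rightarrow> bool" where
  "stoch_int M e w G t Z \<longleftrightarrow> Z \<in> borel_measurable M \<and>
     (\<exists>Y. (\<forall>n. wiener_int M (w n) (\<lambda>s. G s (e n)) t (Y n)) \<and>
          ((\<lambda>K. \<integral>\<^sup>+ \<omega>. ennreal ((norm (Z \<omega> - (\<Sum>n<K. Y n \<omega>)))\<^sup>2) \<partial>M) \<longlonglongrightarrow> 0))"

definition mild_solution :: "'a measure \<Rightarrow> (nat \<Rightarrow> 'v::{real_inner,banach,second_countable_topology}) \<Rightarrow>
     (nat \<Rightarrow> real \<Rightarrow> 'a \<Rightarrow> real) \<Rightarrow> real \<Rightarrow> (real \<Rightarrow> 'v \<Rightarrow> 'v) \<Rightarrow> ('v \<Rightarrow> 'v) \<Rightarrow> ('v \<Rightarrow> 'v) \<Rightarrow>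
     ('a \<Rightarrow> 'v) \<Rightarrow> (real \<Rightarrow> 'a \<Rightarrow> 'v) \<Rightarrow> bool" where
  "mild_solution M e w T S G \<Psi> x0 X \<longleftrightarrow>
     (\<lambda>(s, \<omega>). X s \<omega>) \<in> borel_measurable (restrict_space lborel {0..T} \<Otimes>\<^sub>M M) \<and>
     (\<forall>t\<in>{0..T}. X t \<in> borel_measurable M \<and> integrable M (\<lambda>\<omega>. (norm (X t \<omega>))\<^sup>2)) \<and>
     (\<exists>K. \<forall>t\<in>{0..T}. (\<integral>\<omega>. (norm (X t \<omega>))\<^sup>2 \<partial>M) \<le> K) \<and>
     (\<forall>t\<in>{0..T}. \<exists>Z. stoch_int M e w (\<lambda>s v. S (t - s) (\<Psi> v)) t Z \<and>
        (AE \<omega> in M. set_integrable lborel {0..t} (\<lambda>s. S (t - s) (G (X s \<omega>))) \<and>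
           X t \<omega> = S t (x0 \<omega>) + (\<integral>s\<in>{0..t}. S (t - s) (G (X s \<omega>)) \<partial>lborel) + Z \<omega>))"

end

theory Submission
  imports Defs
begin

text \<open>Writing \<open>\<mu> = 2 H + \<beta> - 1\<close>, the error \<open>X t - X\<^sup>N t\<close> splits into the high-frequency parts of the
  initial term, of the drift convolution and of the stochastic convolution, plus a low-frequency
  drift difference that is absorbed by Gronwall. High frequencies of the initial term gain
  \<open>lam N powr (- \<mu> / 2)\<close> from the regularity of \<open>\<xi>\<close>; those of the drift gain the full \<open>1 / lam N\<close> because
  \<open>exp (- lam N * s)\<close> has integral at most \<open>1 / lam N\<close>, and \<open>\<mu> / 2 < 1\<close>. For the noise, the scalar integral of
  \<open>exp (- l * (t - s))\<close> against a fractional Brownian motion has second moment at most a constant times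
  \<open>l powr (- 2 H)\<close>, uniformly over Riemann sums; summing over coordinates with
  \<open>lam i powr (- 2 H) = lam i powr (- \<mu>) * lam i powr (\<beta> - 1)\<close> leaves the Hilbert-Schmidt norm. The
  noise estimate is carried out on Riemann sums and passes to the limit in mean square.\<close>

section \<open>Coordinates in the eigenbasis\<close>

text \<open>The bound must not degrade with \<open>N\<close>, and this decides how the drifts are
  compared: the decaying factor acts on \<open>F (X s)\<close>, whose second moment is bounded
  before \<open>N\<close> is chosen, while \<open>XN\<close> occurs only in the difference
  \<open>X s - XN s\<close> that Gronwall absorbs. The moment bound for \<open>XN\<close> may
  therefore depend on \<open>N\<close>; it only makes the Gronwall argument finite. Errors are
  squared throughout, so the target is \<open>lam N powr (- \<mu>)\<close>, with
  \<open>lam N\<close> the eigenvalue numbered N + 1 because indices start at 0. Stochastic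
  integrals are available only as mean-square limits, of Riemann sums in each noise coordinate and
  then of the cylindrical sum. Hence the noise bound has to be uniform in the number of nodes and of
  coordinates. Its scalar constant is 8, and each of the two limits doubles it, which gives 32. The
  doublings come from (x + y)^2 <= 2 x^2 + 2 y^2, used in place of Minkowski's inequality because it
  is linear in second moments. The error moments live in \<open>ennreal\<close>, where monotonicity
  and Tonelli need no integrability, and are turned back into real integrals at the end.\<close>

locale spectral_basis =
  fixes e :: "nat \<Rightarrow> 'v::{real_inner,banach}" and lam :: "nat \<Rightarrow> real"
  assumes spec: "spectral_data e lam"
begin

lemma inner_basis: "e i \<bullet> e j = (if i = j then 1 else 0)"
  using spec by (simp add: spectral_data_def)

lemma basis_sums: "(\<lambda>i. (x \<bullet> e i) *\<^sub>R e i) sums x"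
  using spec by (simp add: spectral_data_def)

lemma lam_mono: "i \<le> j \<Longrightarrow> lam i \<le> lam j"
  using spec by (simp add: spectral_data_def mono_def)

lemma lam_pos: "0 < lam i"
  using spec lam_mono[of 0 i] by (simp add: spectral_data_def)

lemma parseval: "(\<lambda>i. (x \<bullet> e i)\<^sup>2) sums (norm x)\<^sup>2"
proof -
  have "(\<lambda>i. ((x \<bullet> e i) *\<^sub>R e i) \<bullet> x) sums (x \<bullet> x)"
    by (rule bounded_linear.sums[OF bounded_linear_inner_left basis_sums])
  then show ?thesis
    by (simp add: power2_norm_eq_inner) (simp add: power2_eq_square inner_commute)
qed

lemma summable_coeff_sq: "summable (\<lambda>i. (x \<bullet> e i)\<^sup>2)"
  using parseval sums_summable by blast

lemma norm_eq_suminf: "(norm x)\<^sup>2 = (\<Sum>i. (x \<bullet> e i)\<^sup>2)"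
  using parseval sums_unique by blast

lemma basis_ext:
  assumes "\<And>i. x \<bullet> e i = y \<bullet> e i"
  shows "x = y"
  using sums_unique2[OF basis_sums[of x]] basis_sums[of y] assms by simp

lemma norm_sq_le_suminf:
  assumes "\<And>i. (x \<bullet> e i)\<^sup>2 \<le> a i" "summable a"
  shows "(norm x)\<^sup>2 \<le> suminf a"
  unfolding norm_eq_suminf by (intro suminf_le assms summable_coeff_sq)

lemma norm_le_coeff:
  assumes "\<And>i. \<bar>x \<bullet> e i\<bar> \<le> c * \<bar>y \<bullet> e i\<bar>" "0 \<le> c"
  shows "norm x \<le> c * norm y"
proof (rule power2_le_imp_le)
  have "(norm x)\<^sup>2 \<le> (\<Sum>i. c\<^sup>2 * (y \<bullet> e i)\<^sup>2)"
  proof (rule norm_sq_le_suminf)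
    fix i show "(x \<bullet> e i)\<^sup>2 \<le> c\<^sup>2 * (y \<bullet> e i)\<^sup>2"
      using power_mono[OF assms(1)[of i], of 2] by (simp add: power_mult_distrib)
  qed (intro summable_mult summable_coeff_sq)
  then show "(norm x)\<^sup>2 \<le> (c * norm y)\<^sup>2"
    by (simp add: suminf_mult summable_coeff_sq norm_eq_suminf power_mult_distrib)
qed (use assms in simp)

lemma norm_sq_sum_basis: "finite I \<Longrightarrow> (norm (\<Sum>i\<in>I. a i *\<^sub>R e i))\<^sup>2 = (\<Sum>i\<in>I. (a i)\<^sup>2)"
  unfolding power2_norm_eq_inner
  by (simp add: inner_sum_left inner_sum_right inner_basis if_distrib sum.delta power2_eq_square
      cong: if_cong)

text \<open>Pythagoras on finite blocks: the squared norm of a block of the series is the matching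
  block of the scalar series, so the Cauchy criterion transfers and completeness does the
  rest.\<close>

lemma summable_basis:
  assumes "summable (\<lambda>i. (a i)\<^sup>2)"
  shows "summable (\<lambda>i. a i *\<^sub>R e i)"
  unfolding summable_Cauchy
proof (intro allI impI)
  fix d :: real assume "d > 0"
  then obtain N where N: "\<And>m n. m \<ge> N \<Longrightarrow> norm (\<Sum>i=m..<n. (a i)\<^sup>2) < d\<^sup>2"
    using assms unfolding summable_Cauchy by (meson zero_less_power)
  have "norm (\<Sum>i=m..<n. a i *\<^sub>R e i) < d" if "m \<ge> N" for m n
  proof (rule power2_less_imp_less)
    show "(norm (\<Sum>i=m..<n. a i *\<^sub>R e i))\<^sup>2 < d\<^sup>2"
      using N[OF that, of n] by (simp add: norm_sq_sum_basis)
  qed (use \<open>d > 0\<close> in simp)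
  then show "\<exists>N. \<forall>m\<ge>N. \<forall>n. norm (\<Sum>i=m..<n. a i *\<^sub>R e i) < d" by blast
qed

lemma inner_suminf_basis:
  assumes "summable (\<lambda>i. (a i)\<^sup>2)"
  shows "(\<Sum>i. a i *\<^sub>R e i) \<bullet> e j = a j"
proof -
  have "(\<lambda>i. (a i *\<^sub>R e i) \<bullet> e j) sums ((\<Sum>i. a i *\<^sub>R e i) \<bullet> e j)"
    by (intro bounded_linear.sums[OF bounded_linear_inner_left] summable_sums summable_basis assms)
  moreover have "(\<lambda>i. (a i *\<^sub>R e i) \<bullet> e j) sums (a j)"
    using sums_If_finite_set[of "{j}" "\<lambda>i. a i"]
    by (simp add: inner_basis if_distrib cong: if_cong)
  ultimately show ?thesis using sums_unique2 by blast
qed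

lemma exp_decay_le_one: "0 \<le> t \<Longrightarrow> exp (- t * lam i) \<le> 1"
  using lam_pos[of i] by simp

text \<open>\<open>semigr\<close> is a bare infinite sum, whose coordinates can be read off once the
  series converges. Nonnegative time guarantees this, because the multipliers are then at most
  1.\<close>

lemma inner_semigr:
  assumes "0 \<le> t"
  shows "semigr e lam t x \<bullet> e j = exp (- t * lam j) * (x \<bullet> e j)"
  unfolding semigr_def
proof (rule inner_suminf_basis, rule summable_comparison_test'[OF summable_coeff_sq[of x]])
  fix i
  have "(exp (- t * lam i))\<^sup>2 \<le> 1"
    using exp_decay_le_one[OF assms, of i] by (simp add: power_le_one)
  then show "norm ((exp (- t * lam i) * (x \<bullet> e i))\<^sup>2) \<le> (x \<bullet> e i)\<^sup>2"
    using mult_right_mono[of "(exp (- t * lam i))\<^sup>2" 1 "(x \<bullet> e i)\<^sup>2"]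
    by (simp add: power_mult_distrib)
qed

lemma inner_sum_basis: "(\<Sum>i<N. a i *\<^sub>R e i) \<bullet> e j = (if j < N then a j else 0)"
  by (simp add: inner_sum_left inner_basis if_distrib sum.delta cong: if_cong)

lemma inner_proj: "proj e N x \<bullet> e j = (if j < N then x \<bullet> e j else 0)"
  unfolding proj_def by (rule inner_sum_basis)

lemma inner_semigr_N:
  "semigr_N e lam N t x \<bullet> e j = (if j < N then exp (- t * lam j) * (x \<bullet> e j) else x \<bullet> e j)"
  unfolding semigr_N_def by (simp add: inner_add_left inner_diff_left inner_proj inner_sum_basis)

text \<open>\<open>semigr_N\<close> is the identity from mode \<open>N\<close> on, but it is applied
  after \<open>proj\<close>, which removes those modes; below \<open>N\<close> the two multipliers
  coincide. Only the tail of the exact semigroup remains.\<close>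

lemma inner_galerkin_diff:
  "0 \<le> t \<Longrightarrow> (semigr e lam t x - semigr_N e lam N t (proj e N x)) \<bullet> e i =
    (if i < N then 0 else exp (- t * lam i) * (x \<bullet> e i))"
  by (simp add: inner_diff_left inner_semigr inner_semigr_N inner_proj)

text \<open>Since E_N(t) P_N = P_N E(t), the difference is the tail of E(t) at \<open>x\<close> plus
  P_N E(t) (x - y). The decay then falls on \<open>x\<close> alone, and the second part is a
  contraction of \<open>x - y\<close>.\<close>

lemma norm_galerkin_diff_le:
  assumes "0 \<le> t"
  shows "norm (semigr e lam t x - semigr_N e lam N t (proj e N y)) \<le>
    exp (- t * lam N) * norm x + norm (x - y)"
proof -
  let ?u = "proj e N (semigr e lam t (x - y))"
  let ?v = "semigr e lam t x - semigr_N e lam N t (proj e N x)"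
  have eq: "semigr e lam t x - semigr_N e lam N t (proj e N y) = ?v + ?u"
    by (rule basis_ext)
      (simp add: inner_diff_left inner_add_left inner_semigr inner_semigr_N inner_proj assms
        algebra_simps)
  have u: "norm ?u \<le> 1 * norm (x - y)"
    by (rule norm_le_coeff)
      (use exp_decay_le_one[OF assms] in \<open>auto simp: inner_proj inner_semigr assms abs_mult
        intro!: mult_left_le_one_le\<close>)
  have v: "norm ?v \<le> exp (- t * lam N) * norm x"
  proof (rule norm_le_coeff)
    fix i show "\<bar>?v \<bullet> e i\<bar> \<le> exp (- t * lam N) * \<bar>x \<bullet> e i\<bar>"
      unfolding inner_galerkin_diff[OF assms]
      by (auto simp: abs_mult intro!: mult_right_mono mult_left_mono lam_mono assms)
  qed simp
  show ?thesis
    unfolding eq using norm_triangle_ineq[of ?v ?u] u v by linarith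
qed

text \<open>The exponential is merely bounded by 1, so the estimate is uniform down to time 0; the
  rate comes from \<open>1 \<le> (lam i / lam N) powr \<mu>\<close> on the tail.\<close>

lemma norm_sq_galerkin_diff_le:
  assumes "0 \<le> t" "0 \<le> \<mu>" and sm: "summable (\<lambda>i. lam i powr \<mu> * (x \<bullet> e i)\<^sup>2)"
  shows "(norm (semigr e lam t x - semigr_N e lam N t (proj e N x)))\<^sup>2 \<le>
    lam N powr (-\<mu>) * Vnorm_sq e lam \<mu> x"
proof -
  have "(norm (semigr e lam t x - semigr_N e lam N t (proj e N x)))\<^sup>2 \<le>
      (\<Sum>i. lam N powr (-\<mu>) * (lam i powr \<mu> * (x \<bullet> e i)\<^sup>2))"
  proof (rule norm_sq_le_suminf)
    fix i
    show "((semigr e lam t x - semigr_N e lam N t (proj e N x)) \<bullet> e i)\<^sup>2 \<le>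
      lam N powr (-\<mu>) * (lam i powr \<mu> * (x \<bullet> e i)\<^sup>2)"
    proof (cases "i < N")
      case False
      have "(exp (- t * lam i))\<^sup>2 \<le> 1"
        using exp_decay_le_one[OF assms(1), of i] by (simp add: power_le_one)
      also have "1 = lam N powr (-\<mu>) * lam N powr \<mu>"
        using lam_pos[of N] by (simp add: powr_minus)
      also have "\<dots> \<le> lam N powr (-\<mu>) * lam i powr \<mu>"
        using False lam_pos[of N] by (intro mult_left_mono powr_mono2 assms lam_mono) auto
      finally show ?thesis
        using False mult_right_mono[of _ _ "(x \<bullet> e i)\<^sup>2"]
        by (simp add: inner_galerkin_diff[OF assms(1)] power_mult_distrib mult.assoc[symmetric])
    qed (simp add: inner_galerkin_diff[OF assms(1)])
  qed (intro summable_mult sm)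
  then show ?thesis by (simp add: Vnorm_sq_def suminf_mult sm)
qed

end

section \<open>Scalar fractional Brownian motion\<close>

text \<open>\<open>std_fbm\<close> prescribes covariances as Bochner integrals, which are 0 for
  non-integrable functions and so certify no integrability. Finite second moments have to come from
  Gaussianity, the degenerate constant case included.\<close>

lemma (in prob_space) gaussian_rv_square_integrable:
  assumes "gaussian_rv M X"
  shows "integrable M (\<lambda>\<omega>. (X \<omega>)\<^sup>2)"
proof -
  have [measurable]: "X \<in> borel_measurable M" using assms by (simp add: gaussian_rv_def)
  consider \<mu> where "AE \<omega> in M. X \<omega> = \<mu>" |
    \<mu> \<sigma> where "0 < \<sigma>" "distributed M lborel X (\<lambda>x. ennreal (normal_density \<mu> \<sigma> x))"
    using assms by (auto simp: gaussian_rv_def)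
  then show ?thesis
  proof cases
    case (1 \<mu>)
    then have "AE \<omega> in M. (X \<omega>)\<^sup>2 = \<mu>\<^sup>2" by auto
    then show ?thesis
      by (subst integrable_cong_AE[where g = "\<lambda>_. \<mu>\<^sup>2"]) auto
  next
    case (2 \<mu> \<sigma>)
    \<comment> \<open>The raw second moment is recovered from the central one: x^2 = (x - \<mu>)^2 +
      2 \<mu> x - \<mu>^2.\<close>
    have "integrable lborel (\<lambda>x. normal_density \<mu> \<sigma> x * (x - \<mu>) ^ 2 +
        (2 * \<mu>) * (normal_density \<mu> \<sigma> x * x) - \<mu>\<^sup>2 * normal_density \<mu> \<sigma> x)"
      using 2 by (intro Bochner_Integration.integrable_diff Bochner_Integration.integrable_add
          integrable_mult_right integrable_normal_moment integrable_normal_moment_nz_1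
          integrable_normal_density)
    also have "(\<lambda>x. normal_density \<mu> \<sigma> x * (x - \<mu>) ^ 2 +
        (2 * \<mu>) * (normal_density \<mu> \<sigma> x * x) - \<mu>\<^sup>2 * normal_density \<mu> \<sigma> x) =
        (\<lambda>x. normal_density \<mu> \<sigma> x * x\<^sup>2)"
      by (auto simp: power2_eq_square algebra_simps)
    finally show ?thesis
      using distributed_integrable[OF 2(2), of "\<lambda>x. x\<^sup>2"] by simp
  qed
qed

lemma integrable_mult_of_square_integrable:
  fixes f g :: "'a \<Rightarrow> real"
  assumes [measurable]: "f \<in> borel_measurable M" "g \<in> borel_measurable M"
    and "integrable M (\<lambda>x. (f x)\<^sup>2)" "integrable M (\<lambda>x. (g x)\<^sup>2)"
  shows "integrable M (\<lambda>x. f x * g x)"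
proof (rule Bochner_Integration.integrable_bound)
  show "integrable M (\<lambda>x. (f x)\<^sup>2 + (g x)\<^sup>2)" using assms by simp
  have "\<bar>f x * g x\<bar> \<le> (f x)\<^sup>2 + (g x)\<^sup>2" for x
    using zero_le_power2[of "\<bar>f x\<bar> - \<bar>g x\<bar>"] mult_nonneg_nonneg[of "\<bar>f x\<bar>" "\<bar>g x\<bar>"]
    unfolding power2_diff abs_mult power2_abs by linarith
  then show "AE x in M. norm (f x * g x) \<le> norm ((f x)\<^sup>2 + (g x)\<^sup>2)" by simp
qed simp

lemma square_integrable_sum:
  fixes f :: "'i \<Rightarrow> 'a \<Rightarrow> real"
  assumes "finite I" and [measurable]: "\<And>i. i \<in> I \<Longrightarrow> f i \<in> borel_measurable M"
    and "\<And>i. i \<in> I \<Longrightarrow> integrable M (\<lambda>x. (f i x)\<^sup>2)"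
  shows "integrable M (\<lambda>x. (\<Sum>i\<in>I. f i x)\<^sup>2)"
  unfolding power2_eq_square sum_product
  by (intro Bochner_Integration.integrable_sum integrable_mult_of_square_integrable assms)

locale fbm = prob_space M for M :: "'a measure" +
  fixes H :: real and b :: "real \<Rightarrow> 'a \<Rightarrow> real"
  assumes fbm: "std_fbm M H b"
begin

lemma fbm_measurable [measurable]: "0 \<le> t \<Longrightarrow> b t \<in> borel_measurable M"
  using fbm by (simp add: std_fbm_def)

lemma fbm_square_integrable:
  assumes "0 \<le> t"
  shows "integrable M (\<lambda>\<omega>. (b t \<omega>)\<^sup>2)"
proof -
  have *: "\<forall>ts cs. length ts = length cs \<longrightarrow> (\<forall>t\<in>set ts. 0 \<le> t) \<longrightarrow>
        gaussian_rv M (\<lambda>\<omega>. \<Sum>i<length ts. cs ! i * b (ts ! i) \<omega>)"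
    using fbm by (simp add: std_fbm_def)
  have "gaussian_rv M (b t)"
    using *[rule_format, of "[t]" "[1]"] assms by simp
  then show ?thesis by (rule gaussian_rv_square_integrable)
qed

lemma fbm_mult_integrable:
  "0 \<le> s \<Longrightarrow> 0 \<le> t \<Longrightarrow> integrable M (\<lambda>\<omega>. b s \<omega> * b t \<omega>)"
  by (intro integrable_mult_of_square_integrable fbm_square_integrable fbm_measurable)

lemma fbm_integrable: "0 \<le> t \<Longrightarrow> integrable M (b t)"
  by (rule square_integrable_imp_integrable[OF fbm_measurable fbm_square_integrable])

lemma fbm_mean: "0 \<le> t \<Longrightarrow> expectation (b t) = 0"
  using fbm by (simp add: std_fbm_def)

lemma fbm_increment:
  assumes "0 \<le> s" "0 \<le> t"
  shows "integrable M (\<lambda>\<omega>. (b t \<omega> - b s \<omega>)\<^sup>2)"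
    and "expectation (\<lambda>\<omega>. (b t \<omega> - b s \<omega>)\<^sup>2) = \<bar>t - s\<bar> powr (2 * H)"
proof -
  have *: "(\<lambda>\<omega>. (b t \<omega> - b s \<omega>)\<^sup>2) = (\<lambda>\<omega>. b t \<omega> * b t \<omega> + b s \<omega> * b s \<omega> - 2 * (b s \<omega> * b t \<omega>))"
    by (auto simp: power2_eq_square algebra_simps)
  show "integrable M (\<lambda>\<omega>. (b t \<omega> - b s \<omega>)\<^sup>2)"
    unfolding * using assms by (simp add: fbm_mult_integrable)
  have cov: "expectation (\<lambda>\<omega>. b s \<omega> * b t \<omega>) =
      (s powr (2*H) + t powr (2*H) - \<bar>t - s\<bar> powr (2*H)) / 2" if "0 \<le> s" "0 \<le> t" for s t
    using fbm that by (simp add: std_fbm_def)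
  show "expectation (\<lambda>\<omega>. (b t \<omega> - b s \<omega>)\<^sup>2) = \<bar>t - s\<bar> powr (2 * H)"
    unfolding * using assms by (simp add: fbm_mult_integrable cov field_simps)
qed

end

text \<open>Discrete integration by parts with the convention g(-1) = 0, so that the first weight
  counts as an increment. In its use \<open>c k = 0\<close>, because the last node is
  \<open>t\<close>, and the boundary term disappears.\<close>

lemma abel_summation_zero:
  fixes c g :: "nat \<Rightarrow> 'a::comm_ring"
  shows "(\<Sum>j<k. g j * (c j - c (Suc j))) =
    (\<Sum>j<k. (g j - (if j = 0 then 0 else g (j - 1))) * c j) - (if k = 0 then 0 else g (k - 1) * c k)"
  by (induction k) (auto simp: algebra_simps)

text \<open>Cauchy-Schwarz after splitting \<open>d\<close> as sqrt(d q) sqrt(d / q). The free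
  weight \<open>q\<close> balances the growth of \<open>c\<close> away from the endpoint against the
  decay of \<open>d\<close>.\<close>

lemma weighted_Cauchy_Schwarz_sum:
  fixes d q c :: "'i \<Rightarrow> real"
  assumes "\<And>i. i \<in> I \<Longrightarrow> 0 \<le> d i" "\<And>i. i \<in> I \<Longrightarrow> 0 < q i"
  shows "(\<Sum>i\<in>I. d i * c i)\<^sup>2 \<le> (\<Sum>i\<in>I. d i * q i) * (\<Sum>i\<in>I. d i / q i * (c i)\<^sup>2)"
proof -
  have "(\<Sum>i\<in>I. d i * c i)\<^sup>2 = (\<Sum>i\<in>I. sqrt (d i * q i) * (sqrt (d i / q i) * c i))\<^sup>2"
  proof (rule arg_cong[where f = "\<lambda>x. x\<^sup>2"], rule sum.cong)
    fix i assume "i \<in> I"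
    then have "sqrt (d i * q i) * sqrt (d i / q i) = d i"
      using assms[of i] by (simp add: real_sqrt_mult[symmetric] real_sqrt_mult_self)
    then show "d i * c i = sqrt (d i * q i) * (sqrt (d i / q i) * c i)"
      by (simp add: mult.assoc[symmetric])
  qed simp
  also have "\<dots> \<le> (\<Sum>i\<in>I. (sqrt (d i * q i))\<^sup>2) * (\<Sum>i\<in>I. (sqrt (d i / q i) * c i)\<^sup>2)"
    by (rule Cauchy_Schwarz_ineq_sum)
  also have "\<dots> = (\<Sum>i\<in>I. d i * q i) * (\<Sum>i\<in>I. d i / q i * (c i)\<^sup>2)"
    using assms by (intro arg_cong2[where f = "(*)"] sum.cong)
      (auto simp: power_mult_distrib less_imp_le)
  finally show ?thesis .
qed

text \<open>Applied with exponent \<open>2 * H\<close>, it trades the power-law variance of an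
  increment for an exponential that the decaying weight can absorb. The cap 2 on the exponent is
  where \<open>H \<le> 1\<close> enters.\<close>

lemma powr_le_two_exp:
  fixes y a :: real
  assumes "0 \<le> y" "0 \<le> a" "a \<le> 2"
  shows "y powr a \<le> 2 * exp y"
proof -
  have "y powr a \<le> 1 + y\<^sup>2"
  proof (cases "y \<le> 1")
    case True
    then have "y powr a \<le> 1 powr a" by (intro powr_mono2 assms)
    then show ?thesis using zero_le_power2[of y] unfolding powr_one_eq_one by linarith
  next
    case False
    then have "y powr a \<le> y powr 2" using assms by (intro powr_mono) auto
    then show ?thesis using False by simp
  qed
  also have "\<dots> \<le> 2 * exp y"
    using exp_lower_Taylor_quadratic[OF assms(1)] assms(1) by simp
  finally show ?thesis .
qed

text \<open>With \<open>a j = exp (- \<lambda> (t - t\<^sub>j) / 2)\<close>, each increment of the weight \<open>a\<^sup>2\<close> divided by \<open>a\<close> is at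
  most twice the increment of \<open>a\<close>, so the sum telescopes.\<close>

lemma sum_weight_increments_le:
  fixes a :: "nat \<Rightarrow> real"
  assumes "\<And>j. 0 < a j" "mono a" "0 < k"
  shows "(\<Sum>j<k. ((a j)\<^sup>2 - (if j = 0 then 0 else (a (j - 1))\<^sup>2)) / a j) \<le> 2 * a (k - 1)"
  using \<open>0 < k\<close>
proof (induction k rule: nat_induct_non_zero)
  case 1
  show ?case using assms(1)[of 0] by (simp add: power2_eq_square)
next
  case (Suc n)
  have le: "a (n - 1) \<le> a n" using assms(2) by (simp add: mono_def)
  have "(a n)\<^sup>2 - (a (n - 1))\<^sup>2 = (a n - a (n - 1)) * (a n + a (n - 1))"
    by (simp add: power2_eq_square algebra_simps)
  also have "\<dots> \<le> (a n - a (n - 1)) * (2 * a n)"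
    using le by (intro mult_left_mono) auto
  finally have "((a n)\<^sup>2 - (a (n - 1))\<^sup>2) / a n \<le> 2 * (a n - a (n - 1))"
    using assms(1)[of n] by (simp add: divide_simps mult_ac)
  then show ?case using Suc by simp
qed

text \<open>Abel summation moves the increments onto the weight, so that only the increments
  \<open>b t - b (j t / k)\<close>, of second moment \<open>(t - j t / k)\<^bsup>2 H\<^esup>\<close>, enter; the double integral with the
  singular kernel \<open>\<bar>r - s\<bar>\<^bsup>2 H - 2\<^esup>\<close> is avoided.\<close>

context fbm
begin

lemma exp_riemann_sum_second_moment:
  fixes t l :: real and k :: nat
  assumes "0 \<le> H" "H \<le> 1" "0 < l" "0 \<le> t"
  defines "S \<equiv> \<lambda>\<omega>. riemann_sum b (\<lambda>s. exp (- (t - s) * l)) t k \<omega>"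
  shows "integrable M (\<lambda>\<omega>. (S \<omega>)\<^sup>2)"
    and "expectation (\<lambda>\<omega>. (S \<omega>)\<^sup>2) \<le> 8 * l powr (- (2 * H))"
proof -
  define \<tau> where "\<tau> j = real j * t / real k" for j
  have \<tau>: "0 \<le> \<tau> j" for j using assms by (simp add: \<tau>_def)
  have S: "S \<omega> = (\<Sum>j<k. (b (\<tau> (Suc j)) \<omega> - b (\<tau> j) \<omega>) * exp (- (t - \<tau> j) * l))" for \<omega>
    unfolding S_def riemann_sum_def \<tau>_def by simp
  have [measurable]: "b (\<tau> j) \<in> borel_measurable M" for j
    using \<tau> by measurable
  show "integrable M (\<lambda>\<omega>. (S \<omega>)\<^sup>2)"
    unfolding S using \<tau>
    by (intro square_integrable_sum) (auto simp: power_mult_distrib intro!: fbm_increment)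
  show "expectation (\<lambda>\<omega>. (S \<omega>)\<^sup>2) \<le> 8 * l powr (- (2 * H))"
  proof (cases "k = 0")
    case True
    then show ?thesis by (simp add: S)
  next
    case k: False
    \<comment> \<open>The half exponent makes \<open>a\<close> the square root of the Riemann
      weight. Cauchy-Schwarz with \<open>q j = 1 / a j\<close> spends one factor \<open>a\<close>,
      and the variance bound, of order 1 / a^2, then turns both resulting sums into the same sum of
      \<open>d j / a j\<close>.\<close>
    define a where "a j = exp (- (t - \<tau> j) * l / 2)" for j
    define d where "d j = (a j)\<^sup>2 - (if j = 0 then 0 else (a (j - 1))\<^sup>2)" for j
    have a_pos: "0 < a j" for j by (simp add: a_def)
    have \<tau>_mono: "\<tau> i \<le> \<tau> j" if "i \<le> j" for i j
      using that assms by (simp add: \<tau>_def divide_right_mono mult_right_mono)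
    have a_sq: "(a j)\<^sup>2 = exp (- (t - \<tau> j) * l)" for j
      by (simp add: a_def power2_eq_square exp_add[symmetric])
    have a_le: "a i \<le> a j" if "i \<le> j" for i j
      unfolding a_def exp_le_cancel_iff
      using \<tau>_mono[OF that] \<open>0 < l\<close> by (intro divide_right_mono mult_right_mono) auto
    have d_nonneg: "0 \<le> d j" for j
      using power_mono[OF a_le, of "j - 1" j 2] a_pos[of "j - 1"] by (simp add: d_def)
    have \<tau>_k: "\<tau> k = t" using k by (simp add: \<tau>_def)
    have sum_d: "(\<Sum>j<k. d j / a j) \<le> 2"
    proof -
      have "(\<Sum>j<k. d j / a j) \<le> 2 * a (k - 1)"
        unfolding d_def using k by (intro sum_weight_increments_le a_pos monoI a_le) auto
      also have "a (k - 1) \<le> a k" by (rule a_le) simp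
      also have "a k = 1" by (simp add: a_def \<tau>_k)
      finally show ?thesis by simp
    qed
    have sum_d0: "0 \<le> (\<Sum>j<k. d j / a j)"
      using d_nonneg a_pos by (intro sum_nonneg divide_nonneg_pos) auto
    define c where "c \<omega> j = b t \<omega> - b (\<tau> j) \<omega>" for \<omega> j
    have S': "S \<omega> = (\<Sum>j<k. d j * c \<omega> j)" for \<omega>
    proof -
      have "S \<omega> = (\<Sum>j<k. (a j)\<^sup>2 * (c \<omega> j - c \<omega> (Suc j)))"
        unfolding S by (intro sum.cong)
          (auto simp: a_sq c_def mult_ac)
      moreover have "c \<omega> k = 0" by (simp add: c_def \<tau>_k)
      ultimately show ?thesis
        using abel_summation_zero[of "\<lambda>j. (a j)\<^sup>2" "c \<omega>" k] by (simp add: d_def)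
    qed
    have int_c: "integrable M (\<lambda>\<omega>. (c \<omega> j)\<^sup>2)" for j
      unfolding c_def using \<tau> assms by (intro fbm_increment)
    have c2: "expectation (\<lambda>\<omega>. (c \<omega> j)\<^sup>2) \<le> 2 * l powr (- (2 * H)) / (a j)\<^sup>2" if "j < k" for j
    proof -
      have "\<tau> j \<le> t" using \<tau>_mono[of j k] that \<tau>_k by simp
      then have "expectation (\<lambda>\<omega>. (c \<omega> j)\<^sup>2) = (t - \<tau> j) powr (2 * H)"
        unfolding c_def using \<tau>[of j] assms by (simp add: fbm_increment)
      \<comment> \<open>Rescaling time by \<open>l\<close> extracts the claimed power of
        \<open>l\<close>; the rest depends only on \<open>(t - \<tau> j) * l\<close> and is
        dominated by twice the reciprocal of the Riemann weight.\<close>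
      also have "\<dots> = l powr (- (2 * H)) * ((t - \<tau> j) * l) powr (2 * H)"
        using \<open>0 < l\<close> \<open>\<tau> j \<le> t\<close> by (simp add: powr_mult powr_minus)
      also have "\<dots> \<le> l powr (- (2 * H)) * (2 * exp ((t - \<tau> j) * l))"
        using assms \<open>\<tau> j \<le> t\<close> by (intro mult_left_mono powr_le_two_exp) auto
      also have "exp ((t - \<tau> j) * l) = 1 / (a j)\<^sup>2"
        unfolding a_sq exp_minus mult_minus_left by (simp add: field_simps)
      finally show ?thesis by (simp add: mult.commute)
    qed
    have "expectation (\<lambda>\<omega>. (S \<omega>)\<^sup>2) \<le>
        expectation (\<lambda>\<omega>. (\<Sum>j<k. d j / a j) * (\<Sum>j<k. d j * a j * (c \<omega> j)\<^sup>2))"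
    proof (rule integral_mono)
      show "integrable M (\<lambda>\<omega>. (\<Sum>j<k. d j / a j) * (\<Sum>j<k. d j * a j * (c \<omega> j)\<^sup>2))"
        using int_c by simp
      fix \<omega>
      show "(S \<omega>)\<^sup>2 \<le> (\<Sum>j<k. d j / a j) * (\<Sum>j<k. d j * a j * (c \<omega> j)\<^sup>2)"
        using weighted_Cauchy_Schwarz_sum[of "{..<k}" d "\<lambda>j. 1 / a j" "c \<omega>"] d_nonneg a_pos
        by (simp add: S')
    qed fact
    also have "\<dots> = (\<Sum>j<k. d j / a j) * (\<Sum>j<k. d j * a j * expectation (\<lambda>\<omega>. (c \<omega> j)\<^sup>2))"
      using int_c by simp
    also have "\<dots> \<le> (\<Sum>j<k. d j / a j) * (\<Sum>j<k. d j * a j * (2 * l powr (- (2 * H)) / (a j)\<^sup>2))"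
      using d_nonneg a_pos by (intro mult_left_mono sum_mono sum_d0 c2) (auto simp: less_imp_le)
    also have "(\<Sum>j<k. d j * a j * (2 * l powr (- (2 * H)) / (a j)\<^sup>2)) =
        2 * l powr (- (2 * H)) * (\<Sum>j<k. d j / a j)"
      unfolding sum_distrib_left using a_pos
      by (intro sum.cong) (auto simp: power2_eq_square field_simps less_imp_neq[symmetric])
    also have "(\<Sum>j<k. d j / a j) * (2 * l powr (- (2 * H)) * (\<Sum>j<k. d j / a j)) =
        2 * l powr (- (2 * H)) * (\<Sum>j<k. d j / a j)\<^sup>2"
      by (simp add: power2_eq_square)
    \<comment> \<open>The constant 8: a factor 2 from the exponential bound and
      \<open>2\<^sup>2\<close> from the squared telescoping sum.\<close>
    also have "\<dots> \<le> 2 * l powr (- (2 * H)) * 2\<^sup>2"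
      using sum_d sum_d0 by (intro mult_left_mono power_mono) auto
    finally show ?thesis by simp
  qed
qed

end

section \<open>Mean-square limits and independent fractional Brownian motions\<close>

text \<open>Valued in \<open>ennreal\<close> so that second moments can be estimated before any
  integrability is known; the shape matches the limit clauses of \<open>wiener_int\<close> and
  \<open>stoch_int\<close>.\<close>

definition mean_sq :: "'a measure \<Rightarrow> ('a \<Rightarrow> 'v::real_normed_vector) \<Rightarrow> ennreal" where
  "mean_sq M U = (\<integral>\<^sup>+ \<omega>. ennreal ((norm (U \<omega>))\<^sup>2) \<partial>M)"

definition mean_sq_tendsto ::
    "'a measure \<Rightarrow> (nat \<Rightarrow> 'a \<Rightarrow> 'v::real_normed_vector) \<Rightarrow> ('a \<Rightarrow> 'v) \<Rightarrow> bool" where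
  "mean_sq_tendsto M Uk U \<longleftrightarrow> (\<lambda>k. mean_sq M (\<lambda>\<omega>. U \<omega> - Uk k \<omega>)) \<longlonglongrightarrow> 0"

lemma sum_square_le_two: "(x + y)\<^sup>2 \<le> 2 * x\<^sup>2 + 2 * (y::real)\<^sup>2"
  using zero_le_power2[of "x - y"] by (simp add: power2_sum power2_diff)

lemma mean_sq_add_le:
  fixes U V :: "'a \<Rightarrow> 'v::{real_normed_vector,second_countable_topology}"
  assumes [measurable]: "U \<in> borel_measurable M" "V \<in> borel_measurable M"
  shows "mean_sq M (\<lambda>\<omega>. U \<omega> + V \<omega>) \<le> 2 * mean_sq M U + 2 * mean_sq M V"
proof -
  have "mean_sq M (\<lambda>\<omega>. U \<omega> + V \<omega>) \<le>
      (\<integral>\<^sup>+ \<omega>. 2 * ennreal ((norm (U \<omega>))\<^sup>2) + 2 * ennreal ((norm (V \<omega>))\<^sup>2) \<partial>M)"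
    unfolding mean_sq_def
  proof (rule nn_integral_mono)
    fix \<omega>
    have "(norm (U \<omega> + V \<omega>))\<^sup>2 \<le> (norm (U \<omega>) + norm (V \<omega>))\<^sup>2"
      by (intro power_mono norm_triangle_ineq) simp
    also have "\<dots> \<le> 2 * (norm (U \<omega>))\<^sup>2 + 2 * (norm (V \<omega>))\<^sup>2"
      by (rule sum_square_le_two)
    finally have "ennreal ((norm (U \<omega> + V \<omega>))\<^sup>2) \<le> ennreal (2 * (norm (U \<omega>))\<^sup>2 + 2 * (norm (V \<omega>))\<^sup>2)"
      by (rule ennreal_leI)
    then show "ennreal ((norm (U \<omega> + V \<omega>))\<^sup>2) \<le>
        2 * ennreal ((norm (U \<omega>))\<^sup>2) + 2 * ennreal ((norm (V \<omega>))\<^sup>2)"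
      by (simp add: ennreal_plus ennreal_mult)
  qed
  also have "\<dots> = 2 * mean_sq M U + 2 * mean_sq M V"
    unfolding mean_sq_def by (simp add: nn_integral_add nn_integral_cmult)
  finally show ?thesis .
qed

lemma mean_sq_uminus: "mean_sq M (\<lambda>\<omega>. - U \<omega>) = mean_sq M U"
  by (simp add: mean_sq_def)

lemma mean_sq_tendsto_add:
  fixes U V :: "'a \<Rightarrow> 'v::{real_normed_vector,second_countable_topology}"
  assumes [measurable]: "U \<in> borel_measurable M" "V \<in> borel_measurable M"
      "\<And>k. Uk k \<in> borel_measurable M" "\<And>k. Vk k \<in> borel_measurable M"
    and lim: "mean_sq_tendsto M Uk U" "mean_sq_tendsto M Vk V"
  shows "mean_sq_tendsto M (\<lambda>k \<omega>. Uk k \<omega> + Vk k \<omega>) (\<lambda>\<omega>. U \<omega> + V \<omega>)"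
  unfolding mean_sq_tendsto_def
proof (rule tendsto_sandwich[OF _ _ tendsto_const])
  have "mean_sq M (\<lambda>\<omega>. (U \<omega> - Uk k \<omega>) + (V \<omega> - Vk k \<omega>)) \<le>
      2 * mean_sq M (\<lambda>\<omega>. U \<omega> - Uk k \<omega>) + 2 * mean_sq M (\<lambda>\<omega>. V \<omega> - Vk k \<omega>)" for k
    by (rule mean_sq_add_le) auto
  then show "\<forall>\<^sub>F k in sequentially. mean_sq M (\<lambda>\<omega>. U \<omega> + V \<omega> - (Uk k \<omega> + Vk k \<omega>)) \<le>
      2 * mean_sq M (\<lambda>\<omega>. U \<omega> - Uk k \<omega>) + 2 * mean_sq M (\<lambda>\<omega>. V \<omega> - Vk k \<omega>)"
    by (simp add: algebra_simps)
  have "(\<lambda>k. 2 * mean_sq M (\<lambda>\<omega>. U \<omega> - Uk k \<omega>) + 2 * mean_sq M (\<lambda>\<omega>. V \<omega> - Vk k \<omega>))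
      \<longlonglongrightarrow> 2 * 0 + 2 * 0"
    using lim unfolding mean_sq_tendsto_def
    by (intro tendsto_add ennreal_tendsto_cmult) auto
  then show "(\<lambda>k. 2 * mean_sq M (\<lambda>\<omega>. U \<omega> - Uk k \<omega>) + 2 * mean_sq M (\<lambda>\<omega>. V \<omega> - Vk k \<omega>))
      \<longlonglongrightarrow> 0" by simp
qed simp

lemma mean_sq_tendsto_uminus:
  assumes "mean_sq_tendsto M Uk U"
  shows "mean_sq_tendsto M (\<lambda>k \<omega>. - Uk k \<omega>) (\<lambda>\<omega>. - U \<omega>)"
proof -
  have "mean_sq M (\<lambda>\<omega>. - U \<omega> - - Uk k \<omega>) = mean_sq M (\<lambda>\<omega>. U \<omega> - Uk k \<omega>)" for k
    unfolding mean_sq_def by (simp add: norm_minus_commute)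
  with assms show ?thesis by (simp add: mean_sq_tendsto_def)
qed

lemma mean_sq_tendsto_diff:
  fixes U V :: "'a \<Rightarrow> 'v::{real_normed_vector,second_countable_topology}"
  assumes "U \<in> borel_measurable M" "V \<in> borel_measurable M"
      "\<And>k. Uk k \<in> borel_measurable M" "\<And>k. Vk k \<in> borel_measurable M"
    and "mean_sq_tendsto M Uk U" "mean_sq_tendsto M Vk V"
  shows "mean_sq_tendsto M (\<lambda>k \<omega>. Uk k \<omega> - Vk k \<omega>) (\<lambda>\<omega>. U \<omega> - V \<omega>)"
  using mean_sq_tendsto_add[of U M "\<lambda>\<omega>. - V \<omega>" Uk "\<lambda>k \<omega>. - Vk k \<omega>"]
    mean_sq_tendsto_uminus[OF assms(6)] assms(1-5)
  by simp

lemma mean_sq_tendsto_sum: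
  fixes U :: "nat \<Rightarrow> 'a \<Rightarrow> 'v::{real_normed_vector,second_countable_topology}"
  assumes [measurable]: "\<And>n. U n \<in> borel_measurable M" "\<And>n k. Uk n k \<in> borel_measurable M"
    and "\<And>n. mean_sq_tendsto M (Uk n) (U n)"
  shows "mean_sq_tendsto M (\<lambda>k \<omega>. \<Sum>n<K. Uk n k \<omega>) (\<lambda>\<omega>. \<Sum>n<(K::nat). U n \<omega>)"
proof (induction K)
  case 0
  show ?case by (simp add: mean_sq_tendsto_def mean_sq_def)
next
  case (Suc K)
  then show ?case by (simp add: mean_sq_tendsto_add assms)
qed

text \<open>Splitting \<open>U\<close> as \<open>(U - Uk) + Uk\<close> costs a factor 2 but requires
  no continuity of second moments under mean-square convergence. A constant is harmless for a
  rate.\<close>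

lemma mean_sq_limit_le:
  fixes U :: "'a \<Rightarrow> 'v::{real_normed_vector,second_countable_topology}"
  assumes [measurable]: "U \<in> borel_measurable M" "\<And>k. Uk k \<in> borel_measurable M"
    and lim: "mean_sq_tendsto M Uk U" and bound: "\<And>k. mean_sq M (Uk k) \<le> B"
  shows "mean_sq M U \<le> 2 * B"
proof (rule tendsto_lowerbound)
  have "(\<lambda>k. 2 * mean_sq M (\<lambda>\<omega>. U \<omega> - Uk k \<omega>) + 2 * B) \<longlonglongrightarrow> 2 * 0 + 2 * B"
    using lim unfolding mean_sq_tendsto_def
    by (intro tendsto_add ennreal_tendsto_cmult tendsto_const) auto
  then show "(\<lambda>k. 2 * mean_sq M (\<lambda>\<omega>. U \<omega> - Uk k \<omega>) + 2 * B) \<longlonglongrightarrow> 2 * B" by simp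
  have "mean_sq M U \<le> 2 * mean_sq M (\<lambda>\<omega>. U \<omega> - Uk k \<omega>) + 2 * B" for k
  proof -
    have "mean_sq M (\<lambda>\<omega>. (U \<omega> - Uk k \<omega>) + Uk k \<omega>) \<le>
        2 * mean_sq M (\<lambda>\<omega>. U \<omega> - Uk k \<omega>) + 2 * mean_sq M (Uk k)"
      by (rule mean_sq_add_le) auto
    also have "\<dots> \<le> 2 * mean_sq M (\<lambda>\<omega>. U \<omega> - Uk k \<omega>) + 2 * B"
      by (intro add_left_mono mult_left_mono bound) auto
    finally show ?thesis by simp
  qed
  then show "\<forall>\<^sub>F k in sequentially. mean_sq M U \<le> 2 * mean_sq M (\<lambda>\<omega>. U \<omega> - Uk k \<omega>) + 2 * B"
    by simp
qed simp

section \<open>Independent fractional Brownian motions\<close>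

locale fbm_family = prob_space M for M :: "'a measure" +
  fixes H :: real and w :: "nat \<Rightarrow> real \<Rightarrow> 'a \<Rightarrow> real"
  assumes fbm_w: "\<And>n. std_fbm M H (w n)"
    and indep_w: "indep_vars (\<lambda>_. Pi\<^sub>M {0..} (\<lambda>_. borel))
                    (\<lambda>n \<omega>. restrict (\<lambda>t. w n t \<omega>) {0..}) UNIV"
begin

lemma fbm_component: "fbm M H (w n)"
  by unfold_locales (rule fbm_w)

lemma riemann_sum_measurable:
  fixes g :: "real \<Rightarrow> 'v::{real_normed_vector,second_countable_topology}"
  assumes "0 \<le> t"
  shows "riemann_sum (w n) g t k \<in> borel_measurable M"
proof -
  have [measurable]: "w n (real j * t / real k) \<in> borel_measurable M" for j
    using assms by (intro fbm.fbm_measurable[OF fbm_component]) simp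
  show ?thesis unfolding riemann_sum_def by measurable
qed

lemma riemann_sum_integrable_mean_zero:
  fixes g :: "real \<Rightarrow> real"
  assumes "0 \<le> t"
  shows "integrable M (riemann_sum (w n) g t k)" "expectation (riemann_sum (w n) g t k) = 0"
proof -
  note int = fbm.fbm_integrable[OF fbm_component] and mean = fbm.fbm_mean[OF fbm_component]
  show "integrable M (riemann_sum (w n) g t k)"
    unfolding riemann_sum_def using assms
    by (intro Bochner_Integration.integrable_sum integrable_scaleR_left
        Bochner_Integration.integrable_diff int) auto
  show "expectation (riemann_sum (w n) g t k) = 0"
    unfolding riemann_sum_def using assms by (simp add: int mean)
qed

text \<open>A Riemann sum reads the path at finitely many times, so it is a measurable functional on
  the product space of paths. Independence of whole paths therefore passes to Riemann sums, and
  these are centred.\<close>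

lemma riemann_sums_uncorrelated:
  fixes g :: "nat \<Rightarrow> real \<Rightarrow> real"
  assumes "0 \<le> t" "n \<noteq> m"
  shows "expectation (\<lambda>\<omega>. riemann_sum (w n) (g n) t k \<omega> * riemann_sum (w m) (g m) t k \<omega>) = 0"
proof -
  \<comment> \<open>The path \<open>p\<close> supplies the noise values directly, so
    \<open>riemann_sum\<close> is reused as a functional on path space. Restriction to nonnegative
    times is invisible to it, as all nodes lie there.\<close>
  define Y where "Y i p = riemann_sum (\<lambda>s p. p s) (g i) t k p" for i :: nat and p :: "real \<Rightarrow> real"
  have Y: "Y i (restrict (\<lambda>t. w i t \<omega>) {0..}) = riemann_sum (w i) (g i) t k \<omega>" for i \<omega>
    using assms by (simp add: Y_def riemann_sum_def)
  have [measurable]: "(\<lambda>p. p (real j * t / real k)) \<in> borel_measurable (Pi\<^sub>M {0..} (\<lambda>_. borel))" for j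
    using assms by (intro measurable_component_singleton) simp
  have "Y i \<in> borel_measurable (Pi\<^sub>M {0..} (\<lambda>_. borel))" for i
    unfolding Y_def riemann_sum_def by measurable
  then have "indep_vars (\<lambda>_. borel) (\<lambda>i \<omega>. Y i (restrict (\<lambda>t. w i t \<omega>) {0..})) {n, m}"
    by (intro indep_vars_compose2[OF indep_vars_subset[OF indep_w]]) auto
  then have "expectation (\<lambda>\<omega>. \<Prod>i\<in>{n, m}. riemann_sum (w i) (g i) t k \<omega>) =
      (\<Prod>i\<in>{n, m}. expectation (riemann_sum (w i) (g i) t k))"
    unfolding Y
    by (intro indep_vars_lebesgue_integral riemann_sum_integrable_mean_zero assms) auto
  then show ?thesis
    using assms by (simp add: riemann_sum_integrable_mean_zero)
qed

lemma exp_riemann_sums_second_moment: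
  fixes a :: "nat \<Rightarrow> real" and t l :: real and k K :: nat
  assumes "0 \<le> H" "H \<le> 1" "0 < l" "0 \<le> t"
  defines "R \<equiv> \<lambda>n \<omega>. riemann_sum (w n) (\<lambda>s. exp (- (t - s) * l)) t k \<omega>"
  shows "mean_sq M (\<lambda>\<omega>. \<Sum>n<K. a n * R n \<omega>) \<le> ennreal (\<Sum>n<K. (a n)\<^sup>2 * (8 * l powr (- (2 * H))))"
proof -
  note moment = fbm.exp_riemann_sum_second_moment[OF fbm_component assms(1-4), folded R_def]
  have R_meas: "R n \<in> borel_measurable M" for n
    unfolding R_def using riemann_sum_measurable[OF assms(4)] by simp
  have int: "integrable M (\<lambda>\<omega>. (a n * R n \<omega>) * (a m * R m \<omega>))" for n m
    using R_meas moment
    by (intro integrable_mult_of_square_integrable)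
      (auto simp: power_mult_distrib R_def)
  have "integrable M (\<lambda>\<omega>. (\<Sum>n<K. a n * R n \<omega>)\<^sup>2)"
    unfolding power2_eq_square sum_product using int by simp
  then have "mean_sq M (\<lambda>\<omega>. \<Sum>n<K. a n * R n \<omega>) = ennreal (expectation (\<lambda>\<omega>. (\<Sum>n<K. a n * R n \<omega>)\<^sup>2))"
    unfolding mean_sq_def by (subst nn_integral_eq_integral[symmetric]) auto
  also have "expectation (\<lambda>\<omega>. (\<Sum>n<K. a n * R n \<omega>)\<^sup>2) =
      (\<Sum>n<K. \<Sum>m<K. expectation (\<lambda>\<omega>. (a n * R n \<omega>) * (a m * R m \<omega>)))"
    unfolding power2_eq_square sum_product using int by simp
  also have "\<dots> = (\<Sum>n<K. \<Sum>m<K. if n = m then (a n)\<^sup>2 * expectation (\<lambda>\<omega>. (R n \<omega>)\<^sup>2) else 0)"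
  proof (intro sum.cong refl)
    fix n m
    have "expectation (\<lambda>\<omega>. (a n * R n \<omega>) * (a m * R m \<omega>)) =
        (a n * a m) * expectation (\<lambda>\<omega>. R n \<omega> * R m \<omega>)"
      by (subst integral_mult_right_zero[symmetric]) (simp add: mult_ac)
    then show "expectation (\<lambda>\<omega>. (a n * R n \<omega>) * (a m * R m \<omega>)) =
        (if n = m then (a n)\<^sup>2 * expectation (\<lambda>\<omega>. (R n \<omega>)\<^sup>2) else 0)"
      using riemann_sums_uncorrelated[OF assms(4), of n m "\<lambda>_ s. exp (- (t - s) * l)" k]
      by (simp add: R_def power2_eq_square)
  qed
  also have "\<dots> \<le> (\<Sum>n<K. (a n)\<^sup>2 * (8 * l powr (- (2 * H))))"
    using moment(2) by (auto simp: sum.delta R_def intro!: sum_mono mult_left_mono)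
  finally show ?thesis by (simp add: ennreal_leI)
qed

end

section \<open>Spectral truncation of the noise\<close>

locale galerkin_noise = spectral_basis e lam + fbm_family M H w
  for e :: "nat \<Rightarrow> 'v::{real_inner,banach,second_countable_topology}" and lam :: "nat \<Rightarrow> real"
    and M :: "'a measure" and H :: real and w :: "nat \<Rightarrow> real \<Rightarrow> 'a \<Rightarrow> real" +
  fixes \<beta> :: real and \<Phi> :: "'v \<Rightarrow> 'v"
  assumes H_nonneg: "0 \<le> H" and H_le: "H \<le> 1" and \<beta>_gt: "1 - 2 * H < \<beta>"
    and \<Phi>_HS: "\<And>n. summable (\<lambda>k. lam k powr (\<beta> - 1) * (\<Phi> (e n) \<bullet> e k)\<^sup>2)"
      "summable (\<lambda>n. \<Sum>k. lam k powr (\<beta> - 1) * (\<Phi> (e n) \<bullet> e k)\<^sup>2)"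
begin

text \<open>The squared Hilbert-Schmidt norm of A^((\<beta> - 1)/2) \<Phi>: the inner sum is the
  squared norm of that operator at \<open>e n\<close>.\<close>

definition HS_sq :: real where
  "HS_sq = (\<Sum>n. \<Sum>k. lam k powr (\<beta> - 1) * (\<Phi> (e n) \<bullet> e k)\<^sup>2)"

lemma HS_nonneg: "0 \<le> (\<Sum>k. lam k powr (\<beta> - 1) * (\<Phi> (e n) \<bullet> e k)\<^sup>2)"
  by (intro suminf_nonneg \<Phi>_HS) auto

lemma HS_sq_nonneg: "0 \<le> HS_sq"
  unfolding HS_sq_def by (intro suminf_nonneg \<Phi>_HS HS_nonneg)

text \<open>The basis diagonalises both semigroups at once, so a coordinate of a vector Riemann sum
  is a fixed coefficient times a scalar exponential one, to which the scalar estimate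
  applies.\<close>

lemma inner_riemann_sum_galerkin_diff:
  assumes "0 \<le> t"
  shows "(riemann_sum b (\<lambda>s. semigr e lam (t - s) x) t k \<omega> -
      riemann_sum b (\<lambda>s. semigr_N e lam N (t - s) (proj e N x)) t k \<omega>) \<bullet> e i =
    (if i < N then 0 else (x \<bullet> e i) * riemann_sum b (\<lambda>s. exp (- (t - s) * lam i)) t k \<omega>)"
proof -
  \<comment> \<open>Nodes are left endpoints, so the semigroup is only evaluated at nonnegative
    times, as \<open>inner_galerkin_diff\<close> demands.\<close>
  have le: "0 \<le> t - real j * t / real k" if "j < k" for j
    using that assms mult_right_mono[of "real j" "real k" t] by (simp add: field_simps)
  have "(riemann_sum b (\<lambda>s. semigr e lam (t - s) x) t k \<omega> -
      riemann_sum b (\<lambda>s. semigr_N e lam N (t - s) (proj e N x)) t k \<omega>) \<bullet> e i =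
    (\<Sum>j<k. (b (real (Suc j) * t / real k) \<omega> - b (real j * t / real k) \<omega>) *
      ((semigr e lam (t - real j * t / real k) x -
        semigr_N e lam N (t - real j * t / real k) (proj e N x)) \<bullet> e i))"
    unfolding riemann_sum_def
    by (simp add: sum_subtractf[symmetric] scaleR_diff_right[symmetric] inner_sum_left del: of_nat_Suc)
  also have "\<dots> = (\<Sum>j<k. (b (real (Suc j) * t / real k) \<omega> - b (real j * t / real k) \<omega>) *
      (if i < N then 0 else exp (- (t - real j * t / real k) * lam i) * (x \<bullet> e i)))"
    by (intro sum.cong refl arg_cong2[where f = "(*)"] inner_galerkin_diff le) simp
  finally show ?thesis
    by (simp add: riemann_sum_def sum_distrib_left mult_ac del: of_nat_Suc)
qed

text \<open>Parseval and Tonelli reduce the claim to a single spectral mode, where independence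
  removes the cross terms between noise coordinates. Cross terms between modes never arise, although
  all modes are driven by the same noises.\<close>

lemma mean_sq_riemann_sums_galerkin_diff:
  fixes t :: real and k K N :: nat
  assumes t: "0 \<le> t"
  defines "D \<equiv> \<lambda>n \<omega>. riemann_sum (w n) (\<lambda>s. semigr e lam (t - s) (\<Phi> (e n))) t k \<omega> -
    riemann_sum (w n) (\<lambda>s. semigr_N e lam N (t - s) (proj e N (\<Phi> (e n)))) t k \<omega>"
  shows "mean_sq M (\<lambda>\<omega>. \<Sum>n<K. D n \<omega>) \<le>
    ennreal (8 * lam N powr (- (2 * H + \<beta> - 1)) * HS_sq)"
proof -
  define \<mu> where "\<mu> = 2 * H + \<beta> - 1"
  define R where "R i n \<omega> = riemann_sum (w n) (\<lambda>s. exp (- (t - s) * lam i)) t k \<omega>" for i n \<omega>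
  define a where "a i n = (if i < N then 0 else \<Phi> (e n) \<bullet> e i)" for i n
  have comp: "(\<Sum>n<K. D n \<omega>) \<bullet> e i = (\<Sum>n<K. a i n * R i n \<omega>)" for i \<omega>
    unfolding inner_sum_left D_def inner_riemann_sum_galerkin_diff[OF t] a_def R_def
    by (intro sum.cong) auto
  have [measurable]: "R i n \<in> borel_measurable M" for i n
    unfolding R_def using riemann_sum_measurable[OF t] by simp
  define h where "h i n = lam i powr (\<beta> - 1) * (\<Phi> (e n) \<bullet> e i)\<^sup>2" for i n
  have h_nonneg: "0 \<le> h i n" for i n by (simp add: h_def)
  have sm: "summable (\<lambda>i. 8 * lam N powr (-\<mu>) * (\<Sum>n<K. h i n))"
    unfolding h_def by (intro summable_mult summable_sum \<Phi>_HS)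
  have "mean_sq M (\<lambda>\<omega>. \<Sum>n<K. D n \<omega>) = (\<integral>\<^sup>+ \<omega>. (\<Sum>i. ennreal ((\<Sum>n<K. a i n * R i n \<omega>)\<^sup>2)) \<partial>M)"
    unfolding mean_sq_def norm_eq_suminf comp[symmetric]
    by (intro nn_integral_cong suminf_ennreal2[symmetric] summable_coeff_sq) simp
  also have "\<dots> = (\<Sum>i. \<integral>\<^sup>+ \<omega>. ennreal ((\<Sum>n<K. a i n * R i n \<omega>)\<^sup>2) \<partial>M)"
    by (rule nn_integral_suminf) measurable
  also have "\<dots> \<le> (\<Sum>i. ennreal (8 * lam N powr (-\<mu>) * (\<Sum>n<K. h i n)))"
  proof (rule suminf_le)
    fix i
    have "(\<integral>\<^sup>+ \<omega>. ennreal ((\<Sum>n<K. a i n * R i n \<omega>)\<^sup>2) \<partial>M) =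
        mean_sq M (\<lambda>\<omega>. \<Sum>n<K. a i n * R i n \<omega>)"
      by (simp add: mean_sq_def)
    also have "\<dots> \<le> ennreal (\<Sum>n<K. (a i n)\<^sup>2 * (8 * lam i powr (- (2 * H))))"
      unfolding R_def by (intro exp_riemann_sums_second_moment H_nonneg H_le lam_pos t)
    also have "\<dots> \<le> ennreal (8 * lam N powr (-\<mu>) * (\<Sum>n<K. h i n))"
      unfolding sum_distrib_left
    proof (intro ennreal_leI sum_mono)
      fix n
      show "(a i n)\<^sup>2 * (8 * lam i powr (- (2 * H))) \<le> 8 * lam N powr (-\<mu>) * h i n"
      proof (cases "i < N")
        case True
        then show ?thesis using h_nonneg by (simp add: a_def)
      next
        case False
        have "lam i powr (- (2 * H)) = lam i powr (-\<mu>) * lam i powr (\<beta> - 1)"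
          by (simp add: powr_add[symmetric] \<mu>_def)
        \<comment> \<open>Since \<open>\<mu>\<close> is positive the negative power is decreasing,
          so the tail eigenvalue \<open>lam i\<close> may be replaced by
          \<open>lam N\<close>.\<close>
        also have "\<dots> \<le> lam N powr (-\<mu>) * lam i powr (\<beta> - 1)"
          using False \<beta>_gt lam_pos lam_mono[of N i]
          by (intro mult_right_mono powr_mono2') (auto simp: \<mu>_def)
        finally have "8 * (a i n)\<^sup>2 * lam i powr (- (2 * H)) \<le>
            8 * (a i n)\<^sup>2 * (lam N powr (-\<mu>) * lam i powr (\<beta> - 1))"
          by (intro mult_left_mono) auto
        then show ?thesis using False by (simp add: a_def h_def mult_ac)
      qed
    qed
    finally show "(\<integral>\<^sup>+ \<omega>. ennreal ((\<Sum>n<K. a i n * R i n \<omega>)\<^sup>2) \<partial>M) \<le>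
      ennreal (8 * lam N powr (-\<mu>) * (\<Sum>n<K. h i n))" .
  qed auto
  also have "\<dots> = ennreal (\<Sum>i. 8 * lam N powr (-\<mu>) * (\<Sum>n<K. h i n))"
    using sm by (intro suminf_ennreal2 mult_nonneg_nonneg sum_nonneg h_nonneg) auto
  also have "(\<Sum>i. 8 * lam N powr (-\<mu>) * (\<Sum>n<K. h i n)) = 8 * lam N powr (-\<mu>) * (\<Sum>n<K. \<Sum>i. h i n)"
    using \<Phi>_HS by (simp add: suminf_mult suminf_sum summable_sum h_def)
  \<comment> \<open>Partial sums of nonnegative terms are dominated by the full series, which
    removes the dependence on \<open>K\<close>.\<close>
  also have "\<dots> \<le> 8 * lam N powr (-\<mu>) * HS_sq"
    unfolding HS_sq_def h_def using HS_nonneg \<Phi>_HS(2)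
    by (intro mult_left_mono sum_le_suminf) auto
  finally show ?thesis by (simp add: \<mu>_def ennreal_leI)
qed

text \<open>The difference of the two integrals is formed before either limit is taken, since only
  the difference is small; the mesh limit comes first, then the limit in the number of noise
  coordinates.\<close>

lemma mean_sq_stoch_int_galerkin_diff:
  assumes t: "0 \<le> t"
    and Z: "stoch_int M e w (\<lambda>s v. semigr e lam (t - s) (\<Phi> v)) t Z"
    and ZN: "stoch_int M e w (\<lambda>s v. semigr_N e lam N (t - s) ((proj e N \<circ> \<Phi>) v)) t ZN"
  shows "mean_sq M (\<lambda>\<omega>. Z \<omega> - ZN \<omega>) \<le> ennreal (32 * lam N powr (- (2 * H + \<beta> - 1)) * HS_sq)"
proof -
  let ?B = "ennreal (8 * lam N powr (- (2 * H + \<beta> - 1)) * HS_sq)"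
  obtain Y where Y: "\<And>n. wiener_int M (w n) (\<lambda>s. semigr e lam (t - s) (\<Phi> (e n))) t (Y n)"
    and Z': "Z \<in> borel_measurable M" "mean_sq_tendsto M (\<lambda>K \<omega>. \<Sum>n<K. Y n \<omega>) Z"
    using Z unfolding stoch_int_def mean_sq_tendsto_def mean_sq_def by blast
  obtain YN where YN: "\<And>n. wiener_int M (w n) (\<lambda>s. semigr_N e lam N (t - s) (proj e N (\<Phi> (e n)))) t (YN n)"
    and ZN': "ZN \<in> borel_measurable M" "mean_sq_tendsto M (\<lambda>K \<omega>. \<Sum>n<K. YN n \<omega>) ZN"
    using ZN unfolding stoch_int_def mean_sq_tendsto_def mean_sq_def comp_def by blast
  have [measurable]: "Y n \<in> borel_measurable M" "YN n \<in> borel_measurable M" for n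
    using Y YN by (auto simp: wiener_int_def)
  let ?R = "\<lambda>n k \<omega>. riemann_sum (w n) (\<lambda>s. semigr e lam (t - s) (\<Phi> (e n))) t k \<omega> -
    riemann_sum (w n) (\<lambda>s. semigr_N e lam N (t - s) (proj e N (\<Phi> (e n)))) t k \<omega>"
  have partial: "mean_sq M (\<lambda>\<omega>. \<Sum>n<K. Y n \<omega> - YN n \<omega>) \<le> 2 * ?B" for K
  proof (rule mean_sq_limit_le)
    show "mean_sq_tendsto M (\<lambda>k \<omega>. \<Sum>n<K. ?R n k \<omega>) (\<lambda>\<omega>. \<Sum>n<K. Y n \<omega> - YN n \<omega>)"
      using Y YN unfolding wiener_int_def
      by (intro mean_sq_tendsto_sum mean_sq_tendsto_diff borel_measurable_diff riemann_sum_measurable t)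
        (auto simp: mean_sq_tendsto_def mean_sq_def)
    show "mean_sq M (\<lambda>\<omega>. \<Sum>n<K. ?R n k \<omega>) \<le> ?B" for k
      by (rule mean_sq_riemann_sums_galerkin_diff[OF t])
  qed (auto intro!: borel_measurable_sum borel_measurable_diff riemann_sum_measurable t)
  have "mean_sq M (\<lambda>\<omega>. Z \<omega> - ZN \<omega>) \<le> 2 * (2 * ?B)"
  proof (rule mean_sq_limit_le)
    show "mean_sq_tendsto M (\<lambda>K \<omega>. \<Sum>n<K. Y n \<omega> - YN n \<omega>) (\<lambda>\<omega>. Z \<omega> - ZN \<omega>)"
      unfolding sum_subtractf using Z' ZN' by (intro mean_sq_tendsto_diff) auto
  qed (use Z' ZN' partial in auto)
  also have "\<dots> = ennreal (2 * (2 * (8 * lam N powr (- (2 * H + \<beta> - 1)) * HS_sq)))"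
    using HS_sq_nonneg by (subst (1 2) ennreal_mult) auto
  finally show ?thesis by (simp add: mult.assoc)
qed

end

section \<open>Integral inequalities\<close>

lemma nn_integral_exp_Icc:
  fixes c t :: real
  assumes "0 < c" "0 \<le> t"
  shows "(\<integral>\<^sup>+ s \<in> {0..t}. ennreal (exp (c * s)) \<partial>lborel) = ennreal ((exp (c * t) - 1) / c)"
proof -
  have "(\<integral>\<^sup>+ s. ennreal (exp (c * s)) * indicator {0..t} s \<partial>lborel) =
      ennreal (exp (c * t) / c - exp (c * 0) / c)"
    using assms by (intro nn_integral_FTC_Icc) (auto intro!: derivative_eq_intros)
  then show ?thesis by (simp add: diff_divide_distrib)
qed

text \<open>A bounded function satisfying the Gronwall inequality is estimated through the supremum of
  \<open>exp (- 2 b t) * \<phi> t\<close>, which is at most \<open>a\<close> plus half of itself; this needs neither continuity nor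
  measurability of \<open>\<phi>\<close>.\<close>

lemma gronwall_bounded:
  fixes \<phi> :: "real \<Rightarrow> ennreal" and a b K T :: real
  assumes "0 \<le> a" "0 < b" "0 \<le> T"
    and bounded: "\<And>t. t \<in> {0..T} \<Longrightarrow> \<phi> t \<le> ennreal K"
    and step: "\<And>t. t \<in> {0..T} \<Longrightarrow>
      \<phi> t \<le> ennreal a + ennreal b * (\<integral>\<^sup>+ s \<in> {0..t}. \<phi> s \<partial>lborel)"
    and t: "t \<in> {0..T}"
  shows "\<phi> t \<le> ennreal (2 * a * exp (2 * b * t))"
proof -
  define f where "f t = enn2real (\<phi> t)" for t
  have \<phi>: "\<phi> t = ennreal (f t)" if "t \<in> {0..T}" for t
    using bounded[OF that] unfolding f_def by (metis ennreal_enn2real le_less_trans ennreal_less_top)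
  define m where "m = (SUP t\<in>{0..T}. exp (- (2 * b * t)) * f t)"
  have f_nonneg: "0 \<le> f t" for t by (simp add: f_def)
  have f_le: "f t \<le> \<bar>K\<bar>" if "t \<in> {0..T}" for t
  proof -
    have "f t \<le> enn2real (ennreal \<bar>K\<bar>)"
      unfolding f_def using bounded[OF that] ennreal_leI[of K "\<bar>K\<bar>"]
      by (intro enn2real_mono) (auto intro: order_trans)
    then show ?thesis by simp
  qed
  have bdd: "bdd_above ((\<lambda>t. exp (- (2 * b * t)) * f t) ` {0..T})"
  proof (rule bdd_aboveI2)
    fix t assume t: "t \<in> {0..T}"
    have "exp (- (2 * b * t)) * f t \<le> 1 * \<bar>K\<bar>"
      using t \<open>0 < b\<close> f_le[OF t] f_nonneg by (intro mult_mono) auto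
    then show "exp (- (2 * b * t)) * f t \<le> \<bar>K\<bar>" by simp
  qed
  have le_m: "exp (- (2 * b * t)) * f t \<le> m" if "t \<in> {0..T}" for t
    unfolding m_def by (rule cSUP_upper[OF that bdd])
  have f_le_m: "f t \<le> m * exp (2 * b * t)" if "t \<in> {0..T}" for t
    using le_m[OF that] by (simp add: exp_minus field_simps)
  have m_nonneg: "0 \<le> m"
    using le_m[OF t] f_nonneg[of t] by (meson exp_ge_zero mult_nonneg_nonneg order_trans)
  have "m \<le> a + m / 2"
    unfolding m_def
  proof (rule cSUP_least, fold m_def)
    fix t assume t: "t \<in> {0..T}"
    \<comment> \<open>The exponent \<open>2 * b\<close> is twice the Gronwall constant, so
      integrating the weight leaves the factor \<open>b / (2 * b)\<close>, the one half in front of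
      \<open>m\<close>.\<close>
    have "(\<integral>\<^sup>+ s \<in> {0..t}. \<phi> s \<partial>lborel) \<le> (\<integral>\<^sup>+ s. ennreal m * (ennreal (exp ((2 * b) * s)) * indicator {0..t} s) \<partial>lborel)"
    proof (rule nn_integral_mono)
      fix s
      show "\<phi> s * indicator {0..t} s \<le> ennreal m * (ennreal (exp ((2 * b) * s)) * indicator {0..t} s)"
        using t f_le_m[of s] m_nonneg
        by (auto simp: indicator_def \<phi> ennreal_mult[symmetric] intro!: ennreal_leI)
    qed
    also have "\<dots> = ennreal m * ennreal ((exp ((2 * b) * t) - 1) / (2 * b))"
      using t \<open>0 < b\<close> by (subst nn_integral_cmult) (auto simp: nn_integral_exp_Icc)
    also have "\<dots> = ennreal (m * ((exp ((2 * b) * t) - 1) / (2 * b)))"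
      using t \<open>0 < b\<close> m_nonneg by (subst ennreal_mult) auto
    finally have "\<phi> t \<le> ennreal a + ennreal b * ennreal (m * ((exp ((2 * b) * t) - 1) / (2 * b)))"
      using step[OF t] by (meson add_left_mono mult_left_mono order_trans zero_le)
    also have "\<dots> = ennreal (a + b * (m * ((exp ((2 * b) * t) - 1) / (2 * b))))"
      using t \<open>0 < b\<close> \<open>0 \<le> a\<close> m_nonneg
      by (subst ennreal_plus) (auto simp: ennreal_mult'[symmetric])
    finally have "ennreal (f t) \<le> ennreal (a + b * (m * ((exp ((2 * b) * t) - 1) / (2 * b))))"
      unfolding \<phi>[OF t] .
    moreover have "0 \<le> a + b * (m * ((exp ((2 * b) * t) - 1) / (2 * b)))"
      using t \<open>0 < b\<close> \<open>0 \<le> a\<close> m_nonneg by (auto intro!: add_nonneg_nonneg mult_nonneg_nonneg)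
    ultimately have "f t \<le> a + b * (m * ((exp ((2 * b) * t) - 1) / (2 * b)))"
      by (simp only: ennreal_le_iff)
    also have "\<dots> = a + m / 2 * exp (2 * b * t) - m / 2"
      using \<open>0 < b\<close> by (simp add: field_simps)
    also have "\<dots> \<le> a * exp (2 * b * t) + m / 2 * exp (2 * b * t)"
      using t \<open>0 < b\<close> \<open>0 \<le> a\<close> m_nonneg mult_left_mono[of 1 "exp (2 * b * t)" a] by simp
    finally have "exp (- (2 * b * t)) * f t \<le>
        exp (- (2 * b * t)) * (a * exp (2 * b * t) + m / 2 * exp (2 * b * t))"
      by (intro mult_left_mono) auto
    also have "\<dots> = a + m / 2" by (simp add: exp_minus field_simps)
    finally show "exp (- (2 * b * t)) * f t \<le> a + m / 2" .
  qed (use \<open>0 \<le> T\<close> in auto)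
  \<comment> \<open>Solving \<open>m \<le> a + m / 2\<close> requires a finite supremum; this is the
    purpose of the a priori bound \<open>K\<close>, of which only finiteness is passed on.\<close>
  then have "m * exp (2 * b * t) \<le> 2 * a * exp (2 * b * t)" by (intro mult_right_mono) auto
  then show ?thesis
    using f_le_m[OF t] unfolding \<phi>[OF t] by (intro ennreal_leI) linarith
qed

text \<open>Cauchy-Schwarz for the measure with density \<open>v\<close>, then Tonelli. If the
  second moments of \<open>G\<close> are bounded, the mass of \<open>v\<close> comes out twice; for
  the exponential weight each copy is at most \<open>1 / lam N\<close>, which gives the squared
  drift error its two powers.\<close>

lemma weighted_nn_integral_mean_sq_le:
  fixes v :: "'s \<Rightarrow> real" and G :: "'s \<Rightarrow> 'a \<Rightarrow> ennreal"
  assumes D: "sigma_finite_measure D" and M: "sigma_finite_measure M"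
    and v[measurable]: "v \<in> borel_measurable D" "\<And>s. 0 \<le> v s"
    and G[measurable]: "(\<lambda>(s, \<omega>). G s \<omega>) \<in> borel_measurable (D \<Otimes>\<^sub>M M)"
  shows "(\<integral>\<^sup>+ \<omega>. (\<integral>\<^sup>+ s. ennreal (v s) * G s \<omega> \<partial>D)\<^sup>2 \<partial>M) \<le>
    (\<integral>\<^sup>+ s. ennreal (v s) \<partial>D) * (\<integral>\<^sup>+ s. ennreal (v s) * (\<integral>\<^sup>+ \<omega>. (G s \<omega>)\<^sup>2 \<partial>M) \<partial>D)"
proof -
  interpret D: sigma_finite_measure D by fact
  interpret M: sigma_finite_measure M by fact
  interpret pair_sigma_finite D M ..
  have sq: "(ennreal (sqrt (v s)))\<^sup>2 = ennreal (v s)" for s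
    using v(2)[of s] by (simp add: ennreal_power)
  have "(\<integral>\<^sup>+ \<omega>. (\<integral>\<^sup>+ s. ennreal (v s) * G s \<omega> \<partial>D)\<^sup>2 \<partial>M) \<le>
      (\<integral>\<^sup>+ \<omega>. (\<integral>\<^sup>+ s. ennreal (v s) \<partial>D) * (\<integral>\<^sup>+ s. ennreal (v s) * (G s \<omega>)\<^sup>2 \<partial>D) \<partial>M)"
  proof (rule nn_integral_mono)
    fix \<omega> assume \<omega>: "\<omega> \<in> space M"
    have [measurable]: "(\<lambda>s. G s \<omega>) \<in> borel_measurable D"
      using measurable_Pair1[OF G \<omega>] by simp
    have "(\<integral>\<^sup>+ s. ennreal (v s) * G s \<omega> \<partial>D)\<^sup>2 =
        (\<integral>\<^sup>+ s. ennreal (sqrt (v s)) * (ennreal (sqrt (v s)) * G s \<omega>) \<partial>D)\<^sup>2"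
      by (simp add: mult.assoc[symmetric] sq[symmetric] power2_eq_square)
    also have "\<dots> \<le> (\<integral>\<^sup>+ s. (ennreal (sqrt (v s)))\<^sup>2 \<partial>D) *
        (\<integral>\<^sup>+ s. (ennreal (sqrt (v s)) * G s \<omega>)\<^sup>2 \<partial>D)"
      by (rule Cauchy_Schwarz_nn_integral) auto
    finally show "(\<integral>\<^sup>+ s. ennreal (v s) * G s \<omega> \<partial>D)\<^sup>2 \<le>
        (\<integral>\<^sup>+ s. ennreal (v s) \<partial>D) * (\<integral>\<^sup>+ s. ennreal (v s) * (G s \<omega>)\<^sup>2 \<partial>D)"
      by (simp add: power_mult_distrib sq)
  qed
  also have "\<dots> = (\<integral>\<^sup>+ s. ennreal (v s) \<partial>D) * (\<integral>\<^sup>+ \<omega>. (\<integral>\<^sup>+ s. ennreal (v s) * (G s \<omega>)\<^sup>2 \<partial>D) \<partial>M)"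
    by (rule nn_integral_cmult) measurable
  also have "(\<integral>\<^sup>+ \<omega>. (\<integral>\<^sup>+ s. ennreal (v s) * (G s \<omega>)\<^sup>2 \<partial>D) \<partial>M) =
      (\<integral>\<^sup>+ s. (\<integral>\<^sup>+ \<omega>. ennreal (v s) * (G s \<omega>)\<^sup>2 \<partial>M) \<partial>D)"
    by (rule Fubini') measurable
  also have "\<dots> = (\<integral>\<^sup>+ s. ennreal (v s) * (\<integral>\<^sup>+ \<omega>. (G s \<omega>)\<^sup>2 \<partial>M) \<partial>D)"
  proof (rule nn_integral_cong)
    fix s assume s: "s \<in> space D"
    have [measurable]: "G s \<in> borel_measurable M"
      using measurable_Pair2[OF G s] by simp
    show "(\<integral>\<^sup>+ \<omega>. ennreal (v s) * (G s \<omega>)\<^sup>2 \<partial>M) = ennreal (v s) * (\<integral>\<^sup>+ \<omega>. (G s \<omega>)\<^sup>2 \<partial>M)"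
      by (rule nn_integral_cmult) measurable
  qed
  finally show ?thesis .
qed

lemma ennreal_square_add_le: "((x::ennreal) + y)\<^sup>2 \<le> 2 * x\<^sup>2 + 2 * y\<^sup>2"
proof (cases "x = \<top> \<or> y = \<top>")
  case True
  then show ?thesis by (auto simp: power2_eq_square ennreal_mult_top ennreal_top_mult)
next
  case False
  then obtain a b where "0 \<le> a" "0 \<le> b" "x = ennreal a" "y = ennreal b"
    by (metis ennreal_cases)
  then show ?thesis
    using sum_square_le_two[of a b]
    by (simp add: ennreal_power ennreal_plus[symmetric] ennreal_mult'[symmetric]
        ennreal_numeral[symmetric] ennreal_leI
        del: ennreal_plus ennreal_numeral)
qed

lemma ennreal_square_add4_le: "((x::ennreal) + y + z + u)\<^sup>2 \<le> 4 * (x\<^sup>2 + y\<^sup>2 + z\<^sup>2 + u\<^sup>2)"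
proof -
  have "(x + y + z + u)\<^sup>2 = ((x + y) + (z + u))\<^sup>2" by (simp add: add.assoc)
  also have "\<dots> \<le> 2 * (x + y)\<^sup>2 + 2 * (z + u)\<^sup>2" by (rule ennreal_square_add_le)
  also have "\<dots> \<le> 2 * (2 * x\<^sup>2 + 2 * y\<^sup>2) + 2 * (2 * z\<^sup>2 + 2 * u\<^sup>2)"
    by (intro add_mono mult_left_mono ennreal_square_add_le) auto
  also have "\<dots> = 4 * (x\<^sup>2 + y\<^sup>2 + z\<^sup>2 + u\<^sup>2)"
    by (simp add: distrib_left mult.assoc[symmetric] add.assoc)
  finally show ?thesis .
qed

section \<open>The error inequality\<close>

context galerkin_noise
begin

text \<open>Integrates \<open>norm_galerkin_diff_le\<close> in time. The interval is moved into the
  weights, so that for every \<open>t\<close> the integrals run over the one measure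
  \<open>D\<close> on which the solutions are jointly measurable.\<close>

lemma galerkin_error_pathwise:
  fixes f g :: "real \<Rightarrow> 'v" and F :: "'v \<Rightarrow> 'v"
  assumes t: "t \<in> {0..T}" and L: "\<And>u v. norm (F u - F v) \<le> L * norm (u - v)"
    and [measurable]: "F \<in> borel_measurable borel"
      "x \<in> borel_measurable (restrict_space lborel {0..T})"
      "y \<in> borel_measurable (restrict_space lborel {0..T})"
    and f: "set_integrable lborel {0..t} (\<lambda>s. semigr e lam (t - s) (F (x s)))"
    and g: "set_integrable lborel {0..t} (\<lambda>s. semigr_N e lam N (t - s) (proj e N (F (y s))))"
  defines "D \<equiv> restrict_space lborel {0..T}"
  shows "ennreal (norm ((\<integral>s\<in>{0..t}. semigr e lam (t - s) (F (x s)) \<partial>lborel) -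
      (\<integral>s\<in>{0..t}. semigr_N e lam N (t - s) (proj e N (F (y s))) \<partial>lborel))) \<le>
    (\<integral>\<^sup>+ s. ennreal (indicator {0..t} s * exp (- (t - s) * lam N)) * ennreal (norm (F (x s))) \<partial>D) +
    (\<integral>\<^sup>+ s. ennreal (indicator {0..t} s) * ennreal (L * norm (x s - y s)) \<partial>D)"
proof -
  let ?f = "\<lambda>s. semigr e lam (t - s) (F (x s))"
  let ?g = "\<lambda>s. semigr_N e lam N (t - s) (proj e N (F (y s)))"
  let ?a = "\<lambda>s. ennreal (indicator {0..t} s * exp (- (t - s) * lam N)) * ennreal (norm (F (x s)))"
  let ?b = "\<lambda>s. ennreal (indicator {0..t} s) * ennreal (L * norm (x s - y s))"
  have [measurable]: "x \<in> borel_measurable D" "y \<in> borel_measurable D"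
    by (simp_all add: D_def)
  have [measurable]: "(\<lambda>s. s) \<in> borel_measurable D"
    unfolding D_def by (rule measurable_restrict_space1) simp
  \<comment> \<open>No sign is prescribed for \<open>L\<close>; the Lipschitz inequality itself
    makes these products nonnegative.\<close>
  have L0: "0 \<le> L * norm (u - v)" for u v :: 'v using L[of u v] norm_ge_zero order_trans by blast
  have "ennreal (norm ((\<integral>s\<in>{0..t}. ?f s \<partial>lborel) - (\<integral>s\<in>{0..t}. ?g s \<partial>lborel))) =
      ennreal (norm (\<integral>s. indicator {0..t} s *\<^sub>R ?f s - indicator {0..t} s *\<^sub>R ?g s \<partial>lborel))"
    using f g unfolding set_lebesgue_integral_def set_integrable_def
    by (subst Bochner_Integration.integral_diff) auto
  also have "\<dots> \<le> (\<integral>\<^sup>+ s. ennreal (norm (indicator {0..t} s *\<^sub>R ?f s - indicator {0..t} s *\<^sub>R ?g s)) \<partial>lborel)"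
    using f g unfolding set_integrable_def
    by (intro integral_norm_bound_ennreal Bochner_Integration.integrable_diff)
  also have "\<dots> \<le> (\<integral>\<^sup>+ s. (?a s + ?b s) * indicator {0..T} s \<partial>lborel)"
  proof (rule nn_integral_mono)
    fix s
    show "ennreal (norm (indicator {0..t} s *\<^sub>R ?f s - indicator {0..t} s *\<^sub>R ?g s)) \<le>
      (?a s + ?b s) * indicator {0..T} s"
    proof (cases "s \<in> {0..t}")
      case True
      then have "0 \<le> t - s" "s \<in> {0..T}" using t by auto
      have "norm (?f s - ?g s) \<le> exp (- (t - s) * lam N) * norm (F (x s)) + norm (F (x s) - F (y s))"
        by (rule norm_galerkin_diff_le) fact
      also have "\<dots> \<le> exp (- (t - s) * lam N) * norm (F (x s)) + L * norm (x s - y s)"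
        using L by simp
      finally have "ennreal (norm (?f s - ?g s)) \<le>
          ennreal (exp (- (t - s) * lam N) * norm (F (x s)) + L * norm (x s - y s))"
        by (rule ennreal_leI)
      also have "\<dots> = ?a s + ?b s"
        using True L0 by (subst ennreal_plus) (auto simp: ennreal_mult)
      finally show ?thesis using True \<open>s \<in> {0..T}\<close> by simp
    qed simp
  qed
  also have "\<dots> = (\<integral>\<^sup>+ s. ?a s + ?b s \<partial>D)"
    unfolding D_def by (subst nn_integral_restrict_space) auto
  also have "\<dots> = (\<integral>\<^sup>+ s. ?a s \<partial>D) + (\<integral>\<^sup>+ s. ?b s \<partial>D)"
    by (intro nn_integral_add) measurable
  finally show ?thesis .
qed

lemma nn_integral_exp_weight_le:
  assumes "t \<in> {0..T}"
  shows "(\<integral>\<^sup>+ s. ennreal (indicator {0..t} s * exp (- (t - s) * lam N)) \<partial>restrict_space lborel {0..T})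
    \<le> ennreal (1 / lam N)"
proof -
  have "(\<integral>\<^sup>+ s. ennreal (indicator {0..t} s * exp (- (t - s) * lam N)) \<partial>restrict_space lborel {0..T}) =
      (\<integral>\<^sup>+ s. ennreal (exp (- (t - s) * lam N)) * indicator {0..t} s \<partial>lborel)"
    using assms
    by (subst nn_integral_restrict_space) (auto intro!: nn_integral_cong simp: indicator_def)
  also have "\<dots> = ennreal (exp (- (t - t) * lam N) / lam N - exp (- (t - 0) * lam N) / lam N)"
    using assms lam_pos[of N]
    by (intro nn_integral_FTC_Icc) (auto intro!: derivative_eq_intros simp: less_imp_neq[symmetric])
  also have "\<dots> \<le> ennreal (1 / lam N)"
    using lam_pos[of N] by (intro ennreal_leI) simp
  finally show ?thesis .
qed

text \<open>The drift contributes a source, controlled through \<open>\<kappa>\<close> by the exact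
  solution alone, and a Lipschitz feedback of the error itself. The factor 4 is the price of
  squaring a sum of four terms.\<close>

lemma galerkin_error_step:
  fixes F :: "'v \<Rightarrow> 'v" and L T \<kappa> :: real and N :: nat and \<xi> :: "'a \<Rightarrow> 'v"
  defines "\<mu> \<equiv> 2 * H + \<beta> - 1"
  assumes L: "\<And>u v. norm (F u - F v) \<le> L * norm (u - v)"
    and \<xi>: "AE \<omega> in M. summable (\<lambda>i. lam i powr \<mu> * (\<xi> \<omega> \<bullet> e i)\<^sup>2)"
      "integrable M (\<lambda>\<omega>. Vnorm_sq e lam \<mu> (\<xi> \<omega>))"
    and X: "mild_solution M e w T (semigr e lam) F \<Phi> \<xi> X"
    and XN: "mild_solution M e w T (semigr_N e lam N) (proj e N \<circ> F) (proj e N \<circ> \<Phi>) (proj e N \<circ> \<xi>) XN"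
    and \<kappa>: "0 \<le> \<kappa>" "\<And>s. s \<in> {0..T} \<Longrightarrow> mean_sq M (\<lambda>\<omega>. F (X s \<omega>)) \<le> ennreal \<kappa>"
    and t: "t \<in> {0..T}"
  shows "mean_sq M (\<lambda>\<omega>. X t \<omega> - XN t \<omega>) \<le>
    ennreal (4 * (lam N powr (-\<mu>) * expectation (\<lambda>\<omega>. Vnorm_sq e lam \<mu> (\<xi> \<omega>)) +
      \<kappa> / (lam N)\<^sup>2 + 32 * lam N powr (-\<mu>) * HS_sq)) +
    ennreal (4 * T * L\<^sup>2) * (\<integral>\<^sup>+ s \<in> {0..t}. mean_sq M (\<lambda>\<omega>. X s \<omega> - XN s \<omega>) \<partial>lborel)"
proof -
  define D where "D = restrict_space lborel {0..T}"
  have D: "sigma_finite_measure D"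
    unfolding D_def by (intro sigma_finite_measure_restrict_space sigma_finite_lborel) simp
  interpret D: sigma_finite_measure D by fact
  have space_D: "space D = {0..T}" by (simp add: D_def)
  have D_le: "0 \<le> t" "t \<le> T" using t by auto
  \<comment> \<open>Testing on the unit vector \<open>e 0\<close> gives the sign of
    \<open>L\<close>.\<close>
  have "0 \<le> L * norm (e 0 - 0)"
    using L[of "e 0" 0] by (meson norm_ge_zero order_trans)
  then have "0 \<le> L"
    using inner_basis[of 0 0] by (auto simp: zero_le_mult_iff)
  have "L-lipschitz_on UNIV F"
    using L \<open>0 \<le> L\<close> by (intro lipschitz_onI) (auto simp: dist_norm)
  then have F_meas [measurable]: "F \<in> borel_measurable borel"
    by (intro borel_measurable_continuous_onI lipschitz_on_continuous_on)
  have XM: "(\<lambda>(s, \<omega>). X s \<omega>) \<in> borel_measurable (D \<Otimes>\<^sub>M M)"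
    and XNM: "(\<lambda>(s, \<omega>). XN s \<omega>) \<in> borel_measurable (D \<Otimes>\<^sub>M M)"
    using X XN unfolding mild_solution_def D_def by auto
  \<comment> \<open>Both orders of the variables are registered: \<open>A\<close> and
    \<open>B\<close> integrate out time and need the order \<open>M\<close>, \<open>D\<close>, while
    second moments integrate out the sample point and need the order \<open>D\<close>,
    \<open>M\<close>.\<close>
  note [measurable] = XM[simplified case_prod_beta'] XNM[simplified case_prod_beta']
    measurable_compose[OF measurable_pair_swap' XM, simplified case_prod_beta' fst_conv snd_conv]
    measurable_compose[OF measurable_pair_swap' XNM, simplified case_prod_beta' fst_conv snd_conv]
  have [measurable]: "X t \<in> borel_measurable M" "XN t \<in> borel_measurable M"
    using X XN t unfolding mild_solution_def by auto
  obtain Z where Z: "stoch_int M e w (\<lambda>s v. semigr e lam (t - s) (\<Phi> v)) t Z"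
    and X_eq: "AE \<omega> in M. set_integrable lborel {0..t} (\<lambda>s. semigr e lam (t - s) (F (X s \<omega>))) \<and>
      X t \<omega> = semigr e lam t (\<xi> \<omega>) + (\<integral>s\<in>{0..t}. semigr e lam (t - s) (F (X s \<omega>)) \<partial>lborel) + Z \<omega>"
    using X t unfolding mild_solution_def by blast
  obtain ZN where ZN: "stoch_int M e w (\<lambda>s v. semigr_N e lam N (t - s) ((proj e N \<circ> \<Phi>) v)) t ZN"
    and XN_eq: "AE \<omega> in M. set_integrable lborel {0..t}
        (\<lambda>s. semigr_N e lam N (t - s) (proj e N (F (XN s \<omega>)))) \<and>
      XN t \<omega> = semigr_N e lam N t (proj e N (\<xi> \<omega>)) +
        (\<integral>s\<in>{0..t}. semigr_N e lam N (t - s) (proj e N (F (XN s \<omega>))) \<partial>lborel) + ZN \<omega>"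
    using XN t unfolding mild_solution_def comp_def by blast
  have [measurable]: "Z \<in> borel_measurable M" "ZN \<in> borel_measurable M"
    using Z ZN by (auto simp: stoch_int_def)
  define v1 where "v1 s = indicator {0..t} s * exp (- (t - s) * lam N)" for s
  define v2 where "v2 s = (indicator {0..t} s :: real)" for s
  have v_nonneg: "0 \<le> v1 s" "0 \<le> v2 s" for s by (simp_all add: v1_def v2_def)
  have v_meas [measurable]: "v1 \<in> borel_measurable D" "v2 \<in> borel_measurable D"
    unfolding D_def v1_def v2_def by (rule measurable_restrict_space1; measurable)+
  define A where "A \<omega> = (\<integral>\<^sup>+ s. ennreal (v1 s) * ennreal (norm (F (X s \<omega>))) \<partial>D)" for \<omega>
  define B where "B \<omega> = (\<integral>\<^sup>+ s. ennreal (v2 s) * ennreal (L * norm (X s \<omega> - XN s \<omega>)) \<partial>D)" for \<omega>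
  have [measurable]: "A \<in> borel_measurable M" "B \<in> borel_measurable M"
    unfolding A_def B_def by measurable
  define V where "V \<omega> = Vnorm_sq e lam \<mu> (\<xi> \<omega>)" for \<omega>
  have [measurable]: "V \<in> borel_measurable M" using \<xi>(2) unfolding V_def by auto
  have \<mu>_pos: "0 \<le> \<mu>" using \<beta>_gt by (simp add: \<mu>_def)
  have V_nonneg: "AE \<omega> in M. 0 \<le> V \<omega>"
    using \<xi>(1) by eventually_elim (auto simp: V_def Vnorm_sq_def intro!: suminf_nonneg)
  have path: "AE \<omega> in M. ennreal ((norm (X t \<omega> - XN t \<omega>))\<^sup>2) \<le>
      4 * (ennreal (lam N powr (-\<mu>) * V \<omega>) + (A \<omega>)\<^sup>2 + (B \<omega>)\<^sup>2 + ennreal ((norm (Z \<omega> - ZN \<omega>))\<^sup>2))"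
    using X_eq XN_eq \<xi>(1) AE_space
  proof eventually_elim
    case (elim \<omega>)
    let ?I = "semigr e lam t (\<xi> \<omega>) - semigr_N e lam N t (proj e N (\<xi> \<omega>))"
    let ?J = "(\<integral>s\<in>{0..t}. semigr e lam (t - s) (F (X s \<omega>)) \<partial>lborel) -
      (\<integral>s\<in>{0..t}. semigr_N e lam N (t - s) (proj e N (F (XN s \<omega>))) \<partial>lborel)"
    have "(\<lambda>s. X s \<omega>) \<in> borel_measurable D" "(\<lambda>s. XN s \<omega>) \<in> borel_measurable D"
      using measurable_Pair1[OF XM] measurable_Pair1[OF XNM] elim by simp_all
    then have J: "ennreal (norm ?J) \<le> A \<omega> + B \<omega>"
      using elim unfolding A_def B_def v1_def v2_def D_def
      by (intro galerkin_error_pathwise t L F_meas) auto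
    have "(norm ?I)\<^sup>2 \<le> lam N powr (-\<mu>) * V \<omega>"
      unfolding V_def using elim \<mu>_pos t by (intro norm_sq_galerkin_diff_le) auto
    then have I: "(ennreal (norm ?I))\<^sup>2 \<le> ennreal (lam N powr (-\<mu>) * V \<omega>)"
      by (simp add: ennreal_power ennreal_leI)
    have eq: "X t \<omega> - XN t \<omega> = ?I + ?J + (Z \<omega> - ZN \<omega>)"
      using elim by (simp add: algebra_simps)
    have "norm (X t \<omega> - XN t \<omega>) \<le> norm ?I + norm ?J + norm (Z \<omega> - ZN \<omega>)"
      unfolding eq
      using norm_triangle_ineq[of "?I + ?J" "Z \<omega> - ZN \<omega>"] norm_triangle_ineq[of ?I ?J] by linarith
    then have "ennreal (norm (X t \<omega> - XN t \<omega>)) \<le> ennreal (norm ?I + norm ?J + norm (Z \<omega> - ZN \<omega>))"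
      by (rule ennreal_leI)
    also have "\<dots> = ennreal (norm ?I) + ennreal (norm ?J) + ennreal (norm (Z \<omega> - ZN \<omega>))"
      by (simp only: ennreal_plus norm_ge_zero add_nonneg_nonneg)
    also have "\<dots> \<le> ennreal (norm ?I) + A \<omega> + B \<omega> + ennreal (norm (Z \<omega> - ZN \<omega>))"
      using add_mono[OF add_mono[OF order_refl J] order_refl] by (simp only: add.assoc)
    finally have "(ennreal (norm (X t \<omega> - XN t \<omega>)))\<^sup>2 \<le>
        (ennreal (norm ?I) + A \<omega> + B \<omega> + ennreal (norm (Z \<omega> - ZN \<omega>)))\<^sup>2"
      by (rule power_mono) simp
    also have "\<dots> \<le> 4 * ((ennreal (norm ?I))\<^sup>2 + (A \<omega>)\<^sup>2 + (B \<omega>)\<^sup>2 + (ennreal (norm (Z \<omega> - ZN \<omega>)))\<^sup>2)"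
      by (rule ennreal_square_add4_le)
    also have "\<dots> \<le> 4 * (ennreal (lam N powr (-\<mu>) * V \<omega>) + (A \<omega>)\<^sup>2 + (B \<omega>)\<^sup>2 +
        (ennreal (norm (Z \<omega> - ZN \<omega>)))\<^sup>2)"
      using I by (intro mult_left_mono add_mono) auto
    finally show ?case by (simp add: ennreal_power)
  qed
  have EV: "(\<integral>\<^sup>+ \<omega>. ennreal (lam N powr (-\<mu>) * V \<omega>) \<partial>M) = ennreal (lam N powr (-\<mu>) * expectation V)"
    using V_nonneg \<xi>(2) by (subst nn_integral_eq_integral) (auto simp: V_def[abs_def])
  have EA: "(\<integral>\<^sup>+ \<omega>. (A \<omega>)\<^sup>2 \<partial>M) \<le> ennreal (\<kappa> / (lam N)\<^sup>2)"
  proof -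
    have "(\<integral>\<^sup>+ \<omega>. (A \<omega>)\<^sup>2 \<partial>M) \<le> (\<integral>\<^sup>+ s. ennreal (v1 s) \<partial>D) *
        (\<integral>\<^sup>+ s. ennreal (v1 s) * (\<integral>\<^sup>+ \<omega>. (ennreal (norm (F (X s \<omega>))))\<^sup>2 \<partial>M) \<partial>D)"
      unfolding A_def
      by (rule weighted_nn_integral_mean_sq_le[OF D sigma_finite_measure_axioms v_meas(1) v_nonneg(1)])
        measurable
    also have "\<dots> \<le> (\<integral>\<^sup>+ s. ennreal (v1 s) \<partial>D) * (\<integral>\<^sup>+ s. ennreal (v1 s) * ennreal \<kappa> \<partial>D)"
      using \<kappa>(2)
      by (intro mult_left_mono nn_integral_mono) (auto simp: mean_sq_def ennreal_power space_D)
    also have "(\<integral>\<^sup>+ s. ennreal (v1 s) * ennreal \<kappa> \<partial>D) = (\<integral>\<^sup>+ s. ennreal (v1 s) \<partial>D) * ennreal \<kappa>"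
      by (rule nn_integral_multc) measurable
    also have "(\<integral>\<^sup>+ s. ennreal (v1 s) \<partial>D) * ((\<integral>\<^sup>+ s. ennreal (v1 s) \<partial>D) * ennreal \<kappa>) \<le>
        ennreal (1 / lam N) * (ennreal (1 / lam N) * ennreal \<kappa>)"
      unfolding v1_def D_def by (intro mult_mono nn_integral_exp_weight_le t) auto
    also have "\<dots> = ennreal (\<kappa> / (lam N)\<^sup>2)"
      using \<kappa>(1) lam_pos[of N] by (simp add: ennreal_mult'[symmetric] power2_eq_square)
    finally show ?thesis .
  qed
  have EB: "(\<integral>\<^sup>+ \<omega>. (B \<omega>)\<^sup>2 \<partial>M) \<le>
      ennreal (T * L\<^sup>2) * (\<integral>\<^sup>+ s \<in> {0..t}. mean_sq M (\<lambda>\<omega>. X s \<omega> - XN s \<omega>) \<partial>lborel)"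
  proof -
    have v2: "(\<integral>\<^sup>+ s. ennreal (v2 s) \<partial>D) = ennreal t"
    proof -
      have "(\<integral>\<^sup>+ s. ennreal (v2 s) \<partial>D) = (\<integral>\<^sup>+ s. ennreal (v2 s) * indicator {0..T} s \<partial>lborel)"
        unfolding D_def by (rule nn_integral_restrict_space) simp
      also have "\<dots> = (\<integral>\<^sup>+ s. indicator {0..t} s \<partial>lborel)"
        using t by (intro nn_integral_cong) (auto simp: v2_def indicator_def)
      finally have "(\<integral>\<^sup>+ s. ennreal (v2 s) \<partial>D) = (\<integral>\<^sup>+ s. indicator {0..t} s \<partial>lborel)" .
      then show ?thesis using t by simp
    qed
    have sq: "(\<integral>\<^sup>+ \<omega>. (ennreal (L * norm (X s \<omega> - XN s \<omega>)))\<^sup>2 \<partial>M) =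
        ennreal (L\<^sup>2) * mean_sq M (\<lambda>\<omega>. X s \<omega> - XN s \<omega>)" if "s \<in> {0..T}" for s
    proof -
      have [measurable]: "X s \<in> borel_measurable M" "XN s \<in> borel_measurable M"
        using X XN that unfolding mild_solution_def by auto
      show ?thesis
        unfolding mean_sq_def using \<open>0 \<le> L\<close>
        by (subst nn_integral_cmult[symmetric])
          (auto simp: ennreal_power power_mult_distrib ennreal_mult)
    qed
    have "(\<integral>\<^sup>+ \<omega>. (B \<omega>)\<^sup>2 \<partial>M) \<le> (\<integral>\<^sup>+ s. ennreal (v2 s) \<partial>D) *
        (\<integral>\<^sup>+ s. ennreal (v2 s) * (\<integral>\<^sup>+ \<omega>. (ennreal (L * norm (X s \<omega> - XN s \<omega>)))\<^sup>2 \<partial>M) \<partial>D)"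
      unfolding B_def
      by (rule weighted_nn_integral_mean_sq_le[OF D sigma_finite_measure_axioms v_meas(2) v_nonneg(2)])
        measurable
    also have "\<dots> = ennreal t * (\<integral>\<^sup>+ s. ennreal (L\<^sup>2) * (ennreal (v2 s) * mean_sq M (\<lambda>\<omega>. X s \<omega> - XN s \<omega>)) \<partial>D)"
      unfolding v2 by (rule arg_cong2[where f = "(*)", OF refl], rule nn_integral_cong)
        (simp add: sq space_D mult.left_commute)
    also have "(\<integral>\<^sup>+ s. ennreal (L\<^sup>2) * (ennreal (v2 s) * mean_sq M (\<lambda>\<omega>. X s \<omega> - XN s \<omega>)) \<partial>D) =
        ennreal (L\<^sup>2) * (\<integral>\<^sup>+ s. ennreal (v2 s) * mean_sq M (\<lambda>\<omega>. X s \<omega> - XN s \<omega>) \<partial>D)"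
      unfolding mean_sq_def by (rule nn_integral_cmult) measurable
    also have "(\<integral>\<^sup>+ s. ennreal (v2 s) * mean_sq M (\<lambda>\<omega>. X s \<omega> - XN s \<omega>) \<partial>D) =
        (\<integral>\<^sup>+ s. ennreal (v2 s) * mean_sq M (\<lambda>\<omega>. X s \<omega> - XN s \<omega>) * indicator {0..T} s \<partial>lborel)"
      unfolding D_def by (rule nn_integral_restrict_space) simp
    also have "\<dots> = (\<integral>\<^sup>+ s \<in> {0..t}. mean_sq M (\<lambda>\<omega>. X s \<omega> - XN s \<omega>) \<partial>lborel)"
      using t by (intro nn_integral_cong) (auto simp: v2_def indicator_def)
    also have "ennreal t * (ennreal (L\<^sup>2) * (\<integral>\<^sup>+ s \<in> {0..t}. mean_sq M (\<lambda>\<omega>. X s \<omega> - XN s \<omega>) \<partial>lborel)) =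
        ennreal (t * L\<^sup>2) * (\<integral>\<^sup>+ s \<in> {0..t}. mean_sq M (\<lambda>\<omega>. X s \<omega> - XN s \<omega>) \<partial>lborel)"
      using t by (simp add: ennreal_mult mult.assoc)
    \<comment> \<open>Passing from \<open>t\<close> to \<open>T\<close> gives Gronwall a constant
      that does not vary with time.\<close>
    also have "\<dots> \<le> ennreal (T * L\<^sup>2) * (\<integral>\<^sup>+ s \<in> {0..t}. mean_sq M (\<lambda>\<omega>. X s \<omega> - XN s \<omega>) \<partial>lborel)"
      using t by (intro mult_right_mono ennreal_leI) auto
    finally show ?thesis .
  qed
  have EZ: "mean_sq M (\<lambda>\<omega>. Z \<omega> - ZN \<omega>) \<le> ennreal (32 * lam N powr (-\<mu>) * HS_sq)"
    unfolding \<mu>_def by (rule mean_sq_stoch_int_galerkin_diff[OF D_le(1) Z ZN])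
  let ?a = "lam N powr (-\<mu>) * expectation V" and ?b = "\<kappa> / (lam N)\<^sup>2"
    and ?c = "32 * lam N powr (-\<mu>) * HS_sq"
    and ?I = "\<integral>\<^sup>+ s \<in> {0..t}. mean_sq M (\<lambda>\<omega>. X s \<omega> - XN s \<omega>) \<partial>lborel"
  have nonneg: "0 \<le> ?a" "0 \<le> ?b" "0 \<le> ?c"
    using V_nonneg \<kappa>(1) HS_sq_nonneg by (auto intro!: mult_nonneg_nonneg integral_nonneg_AE)
  have "mean_sq M (\<lambda>\<omega>. X t \<omega> - XN t \<omega>) \<le> (\<integral>\<^sup>+ \<omega>. 4 * (ennreal (lam N powr (-\<mu>) * V \<omega>) +
      (A \<omega>)\<^sup>2 + (B \<omega>)\<^sup>2 + ennreal ((norm (Z \<omega> - ZN \<omega>))\<^sup>2)) \<partial>M)"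
    unfolding mean_sq_def by (rule nn_integral_mono_AE[OF path])
  also have "\<dots> = 4 * (ennreal ?a + (\<integral>\<^sup>+ \<omega>. (A \<omega>)\<^sup>2 \<partial>M) + (\<integral>\<^sup>+ \<omega>. (B \<omega>)\<^sup>2 \<partial>M) +
      mean_sq M (\<lambda>\<omega>. Z \<omega> - ZN \<omega>))"
    unfolding EV[symmetric] mean_sq_def by (simp add: nn_integral_cmult nn_integral_add)
  also have "\<dots> \<le> 4 * (ennreal ?a + ennreal ?b + ennreal (T * L\<^sup>2) * ?I + ennreal ?c)"
    by (intro mult_left_mono add_mono EA EB EZ order_refl) simp
  also have "\<dots> = 4 * (ennreal ?a + ennreal ?b + ennreal ?c) + 4 * ennreal (T * L\<^sup>2) * ?I"
    by (simp add: distrib_left mult.assoc ac_simps)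
  also have "4 * (ennreal ?a + ennreal ?b + ennreal ?c) = ennreal (4 * (?a + ?b + ?c))"
  proof -
    have "4 * (ennreal x + ennreal y + ennreal z) = ennreal (4 * (x + y + z))"
      if "0 \<le> x" "0 \<le> y" "0 \<le> z" for x y z
      using that by (subst ennreal_mult) auto
    from this[OF nonneg] show ?thesis .
  qed
  also have "4 * ennreal (T * L\<^sup>2) = ennreal (4 * T * L\<^sup>2)"
    using t by (simp add: ennreal_mult' mult.assoc)
  finally show ?thesis by (simp add: V_def)
qed

end

section \<open>Moment bounds and assembly of the rate\<close>

lemma mild_solution_mean_sq_bounded:
  assumes "mild_solution M e w T S G \<Psi> x0 X"
  obtains K where "0 \<le> K" "\<And>t. t \<in> {0..T} \<Longrightarrow> mean_sq M (X t) \<le> ennreal K"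
proof -
  obtain K where K: "\<forall>t\<in>{0..T}. (\<integral>\<omega>. (norm (X t \<omega>))\<^sup>2 \<partial>M) \<le> K"
    and int: "\<And>t. t \<in> {0..T} \<Longrightarrow> integrable M (\<lambda>\<omega>. (norm (X t \<omega>))\<^sup>2)"
    using assms unfolding mild_solution_def by blast
  have "mean_sq M (X t) \<le> ennreal \<bar>K\<bar>" if "t \<in> {0..T}" for t
    unfolding mean_sq_def nn_integral_eq_integral[OF int[OF that] AE_I2[OF zero_le_power2]]
    using K that by (intro ennreal_leI) (meson abs_ge_self order_trans)
  then show thesis by (intro that[of "\<bar>K\<bar>"]) auto
qed

lemma (in prob_space) mean_sq_linear_growth:
  fixes U :: "'a \<Rightarrow> 'v::{real_normed_vector,second_countable_topology}"
  assumes growth: "\<And>u. norm (F u) \<le> L * (norm u + 1)" and [measurable]: "U \<in> borel_measurable M"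
    and K: "0 \<le> K" "mean_sq M U \<le> ennreal K"
  shows "mean_sq M (\<lambda>\<omega>. F (U \<omega>)) \<le> ennreal (2 * L\<^sup>2 * (K + 1))"
proof -
  have "mean_sq M (\<lambda>\<omega>. F (U \<omega>)) \<le> (\<integral>\<^sup>+ \<omega>. ennreal (2 * L\<^sup>2) * (ennreal ((norm (U \<omega>))\<^sup>2) + 1) \<partial>M)"
    unfolding mean_sq_def
  proof (rule nn_integral_mono)
    fix \<omega>
    have "(norm (F (U \<omega>)))\<^sup>2 \<le> (L * (norm (U \<omega>) + 1))\<^sup>2"
      by (intro power_mono growth) simp
    also have "\<dots> \<le> L\<^sup>2 * (2 * (norm (U \<omega>))\<^sup>2 + 2 * 1\<^sup>2)"
      unfolding power_mult_distrib by (intro mult_left_mono sum_square_le_two) simp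
    finally have "ennreal ((norm (F (U \<omega>)))\<^sup>2) \<le> ennreal (2 * L\<^sup>2 * ((norm (U \<omega>))\<^sup>2 + 1))"
      by (intro ennreal_leI) (simp add: algebra_simps)
    then show "ennreal ((norm (F (U \<omega>)))\<^sup>2) \<le> ennreal (2 * L\<^sup>2) * (ennreal ((norm (U \<omega>))\<^sup>2) + 1)"
      by (subst (asm) ennreal_mult) auto
  qed
  also have "\<dots> = ennreal (2 * L\<^sup>2) * (mean_sq M U + 1)"
    unfolding mean_sq_def
    by (subst nn_integral_cmult) (auto simp: nn_integral_add emeasure_space_1)
  also have "\<dots> \<le> ennreal (2 * L\<^sup>2) * (ennreal K + 1)"
    by (intro mult_left_mono add_right_mono K) simp
  also have "\<dots> = ennreal (2 * L\<^sup>2 * (K + 1))"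
    using K(1) by (subst ennreal_mult) auto
  finally show ?thesis .
qed

theorem mainTheorem4:
  fixes M :: "'a measure" and Fs :: "real \<Rightarrow> 'a measure"
    and e :: "nat \<Rightarrow> 'v::{real_inner,banach,second_countable_topology}"
    and lam :: "nat \<Rightarrow> real"
    and F :: "'v \<Rightarrow> 'v" and L :: real
    and w :: "nat \<Rightarrow> real \<Rightarrow> 'a \<Rightarrow> real"
    and H \<beta> T :: real
    and \<Phi> :: "'v \<Rightarrow> 'v"
    and \<xi> :: "'a \<Rightarrow> 'v"
    and X :: "real \<Rightarrow> 'a \<Rightarrow> 'v"
  assumes prob: "prob_space M"
    and filt: "filtration (space M) Fs" and filt_sub: "\<forall>t. sets (Fs t) \<subseteq> sets M"
    and spec: "spectral_data e lam"
    and F_growth: "\<forall>u. norm (F u) \<le> L * (norm u + 1)"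
    and F_lip: "\<forall>u v. norm (F u - F v) \<le> L * norm (u - v)"
    and H: "1/2 < H" "H < 1"
    and \<beta>: "1 - 2*H < \<beta>" "\<beta> \<le> 1"
    and T: "0 < T"
    and fbm: "\<forall>n. std_fbm M H (w n)"
    and fbm_indep: "prob_space.indep_vars M (\<lambda>_. Pi\<^sub>M {0..} (\<lambda>_. borel))
                      (\<lambda>n \<omega>. restrict (\<lambda>t. w n t \<omega>) {0..}) UNIV"
    and adapted: "\<forall>n. \<forall>t\<ge>0. w n t \<in> borel_measurable (Fs t)"
    and Phi_lin: "linear \<Phi>"
    and Phi_HS: "(\<forall>n. summable (\<lambda>k. lam k powr (\<beta> - 1) * (\<Phi> (e n) \<bullet> e k)\<^sup>2)) \<and>
                 summable (\<lambda>n. \<Sum>k. lam k powr (\<beta> - 1) * (\<Phi> (e n) \<bullet> e k)\<^sup>2)"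
    and xi_meas: "\<xi> \<in> borel_measurable (Fs 0)"
    and xi_L2: "AE \<omega> in M. summable (\<lambda>i. lam i powr (2*H + \<beta> - 1) * (\<xi> \<omega> \<bullet> e i)\<^sup>2)"
               "integrable M (\<lambda>\<omega>. Vnorm_sq e lam (2*H + \<beta> - 1) (\<xi> \<omega>))"
    and X_mild: "mild_solution M e w T (semigr e lam) F \<Phi> \<xi> X"
  shows "\<exists>C. \<forall>N\<ge>1. \<forall>XN. mild_solution M e w T (semigr_N e lam N) (proj e N \<circ> F) (proj e N \<circ> \<Phi>)
                              (proj e N \<circ> \<xi>) XN \<longrightarrow>
           (\<forall>t\<in>{0..T}. sqrt (\<integral>\<omega>. (norm (X t \<omega> - XN t \<omega>))\<^sup>2 \<partial>M)
              \<le> C * (1 + sqrt (\<integral>\<omega>. Vnorm_sq e lam (2*H + \<beta> - 1) (\<xi> \<omega>) \<partial>M))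
                  * lam N powr (- (2*H + \<beta> - 1) / 2))"
proof -
  interpret prob_space M by fact
  interpret galerkin_noise e lam M H w \<beta> \<Phi>
    by unfold_locales (use spec fbm fbm_indep H \<beta> Phi_HS in auto)
  define \<mu> where "\<mu> = 2 * H + \<beta> - 1"
  define E where "E = expectation (\<lambda>\<omega>. Vnorm_sq e lam \<mu> (\<xi> \<omega>))"
  have "0 \<le> E"
    unfolding E_def
  proof (rule integral_nonneg_AE)
    show "AE \<omega> in M. 0 \<le> Vnorm_sq e lam \<mu> (\<xi> \<omega>)"
      using xi_L2(1) unfolding \<mu>_def
      by eventually_elim (auto simp: Vnorm_sq_def intro!: suminf_nonneg)
  qed
  obtain K where K: "0 \<le> K" "\<And>t. t \<in> {0..T} \<Longrightarrow> mean_sq M (X t) \<le> ennreal K"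
    using mild_solution_mean_sq_bounded[OF X_mild] by blast
  have X_meas: "X t \<in> borel_measurable M" if "t \<in> {0..T}" for t
    using X_mild that unfolding mild_solution_def by blast
  define \<kappa> where "\<kappa> = 2 * L\<^sup>2 * (K + 1)"
  have "0 \<le> \<kappa>" using K by (simp add: \<kappa>_def)
  have F_mean_sq: "mean_sq M (\<lambda>\<omega>. F (X s \<omega>)) \<le> ennreal \<kappa>" if "s \<in> {0..T}" for s
    unfolding \<kappa>_def using F_growth K that X_meas by (intro mean_sq_linear_growth) auto
  \<comment> \<open>The added 1 keeps \<open>b\<close> positive even for \<open>L = 0\<close>, as
    \<open>gronwall_bounded\<close> divides by it.\<close>
  define b where "b = 4 * T * L\<^sup>2 + 1"
  have "0 < b" using T by (simp add: b_def add_nonneg_pos)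
  \<comment> \<open>The 8 is 2 from Gronwall times 4 from the error inequality. The three summands
    stand for initial value, drift and noise; the power of \<open>lam 0\<close> converts the drift
    rate \<open>lam N powr (- 2)\<close> into \<open>lam N powr (- \<mu>)\<close>.\<close>
  define Q where "Q = 8 * exp (2 * b * T) * (1 + \<kappa> * lam 0 powr (\<mu> - 2) + 32 * HS_sq)"
  have "0 \<le> Q"
    unfolding Q_def using \<open>0 \<le> \<kappa>\<close> HS_sq_nonneg by simp
  show ?thesis
  proof (intro exI[of _ "sqrt Q"] allI impI ballI)
    fix N :: nat and XN t
    assume XN_mild: "mild_solution M e w T (semigr_N e lam N) (proj e N \<circ> F) (proj e N \<circ> \<Phi>)
      (proj e N \<circ> \<xi>) XN" and t: "t \<in> {0..T}"
    obtain K' where K': "0 \<le> K'" "\<And>t. t \<in> {0..T} \<Longrightarrow> mean_sq M (XN t) \<le> ennreal K'"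
      using mild_solution_mean_sq_bounded[OF XN_mild] by blast
    have XN_meas: "XN t \<in> borel_measurable M" if "t \<in> {0..T}" for t
      using XN_mild that unfolding mild_solution_def by blast
    let ?r = "lam N powr (-\<mu>)"
    let ?\<phi> = "\<lambda>t. mean_sq M (\<lambda>\<omega>. X t \<omega> - XN t \<omega>)"
    define a where "a = 4 * (?r * E + \<kappa> / (lam N)\<^sup>2 + 32 * ?r * HS_sq)"
    have "0 \<le> a"
      unfolding a_def using \<open>0 \<le> E\<close> \<open>0 \<le> \<kappa>\<close> HS_sq_nonneg by simp
    have bounded: "?\<phi> s \<le> ennreal (2 * K + 2 * K')" if s: "s \<in> {0..T}" for s
    proof -
      have "?\<phi> s \<le> 2 * mean_sq M (X s) + 2 * mean_sq M (\<lambda>\<omega>. - XN s \<omega>)"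
        using mean_sq_add_le[of "X s" M "\<lambda>\<omega>. - XN s \<omega>"] X_meas[OF s] XN_meas[OF s] by simp
      also have "\<dots> \<le> 2 * ennreal K + 2 * ennreal K'"
        unfolding mean_sq_uminus by (intro add_mono mult_left_mono K K' s) auto
      also have "\<dots> = ennreal (2 * K + 2 * K')"
        using K(1) K'(1) by (simp add: ennreal_mult)
      finally show ?thesis .
    qed
    have step: "?\<phi> s \<le> ennreal a + ennreal b * (\<integral>\<^sup>+ r \<in> {0..s}. ?\<phi> r \<partial>lborel)" if s: "s \<in> {0..T}" for s
    proof -
      have "?\<phi> s \<le> ennreal a + ennreal (4 * T * L\<^sup>2) * (\<integral>\<^sup>+ r \<in> {0..s}. ?\<phi> r \<partial>lborel)"
        unfolding a_def E_def \<mu>_def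
        by (rule galerkin_error_step[OF _ xi_L2 X_mild XN_mild \<open>0 \<le> \<kappa>\<close> F_mean_sq s])
          (use F_lip in auto)
      also have "\<dots> \<le> ennreal a + ennreal b * (\<integral>\<^sup>+ r \<in> {0..s}. ?\<phi> r \<partial>lborel)"
        by (intro add_left_mono mult_right_mono ennreal_leI) (auto simp: b_def)
      finally show ?thesis .
    qed
    have "?\<phi> t \<le> ennreal (2 * a * exp (2 * b * t))"
      by (rule gronwall_bounded[OF \<open>0 \<le> a\<close> \<open>0 < b\<close> less_imp_le[OF T] bounded step t])
    also have "2 * a * exp (2 * b * t) \<le> Q * (1 + E) * ?r"
    proof -
      have "?r * lam N powr (\<mu> - 2) = lam N powr (- 2)"
        by (simp add: powr_add[symmetric])
      then have "1 / (lam N)\<^sup>2 = ?r * lam N powr (\<mu> - 2)"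
        using lam_pos[of N] by (simp add: powr_minus_divide)
      \<comment> \<open>The exponent \<open>\<mu> - 2\<close> is negative, by
        \<open>\<beta> \<le> 1\<close> and \<open>H < 1\<close>, so the power is largest at the
        smallest eigenvalue.\<close>
      also have "\<dots> \<le> ?r * lam 0 powr (\<mu> - 2)"
        using H \<beta> lam_pos[of 0] lam_mono[of 0 N]
        by (intro mult_left_mono powr_mono2') (auto simp: \<mu>_def)
      finally have "\<kappa> * (1 / (lam N)\<^sup>2) \<le> \<kappa> * (?r * lam 0 powr (\<mu> - 2))"
        using \<open>0 \<le> \<kappa>\<close> by (rule mult_left_mono)
      then have "a \<le> 4 * (?r * E + \<kappa> * (?r * lam 0 powr (\<mu> - 2)) + 32 * ?r * HS_sq)"
        unfolding a_def by (intro mult_left_mono add_mono order_refl) auto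
      also have "\<dots> = 4 * ?r * (E + (\<kappa> * lam 0 powr (\<mu> - 2) + 32 * HS_sq))"
        by (simp add: algebra_simps)
      \<comment> \<open>The product form separates the factor \<open>1 + E\<close> of the initial
        value from the quantities collected in \<open>Q\<close>.\<close>
      also have "\<dots> \<le> 4 * ?r * ((1 + (\<kappa> * lam 0 powr (\<mu> - 2) + 32 * HS_sq)) * (1 + E))"
      proof (rule mult_left_mono)
        have "E + c \<le> (1 + c) * (1 + E)" if "0 \<le> c" for c
          using mult_nonneg_nonneg[OF that \<open>0 \<le> E\<close>] by (simp add: algebra_simps)
        then show "E + (\<kappa> * lam 0 powr (\<mu> - 2) + 32 * HS_sq) \<le>
            (1 + (\<kappa> * lam 0 powr (\<mu> - 2) + 32 * HS_sq)) * (1 + E)"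
          using \<open>0 \<le> \<kappa>\<close> HS_sq_nonneg by simp
      qed simp
      finally have "2 * a * exp (2 * b * t) \<le>
          2 * (4 * ?r * ((1 + (\<kappa> * lam 0 powr (\<mu> - 2) + 32 * HS_sq)) * (1 + E))) * exp (2 * b * T)"
        using t \<open>0 < b\<close> \<open>0 \<le> a\<close> by (intro mult_mono) auto
      then show ?thesis by (simp only: Q_def mult_ac add.assoc)
    qed
    finally have "?\<phi> t \<le> ennreal (Q * (1 + E) * ?r)" by (simp add: ennreal_leI)
    then have "expectation (\<lambda>\<omega>. (norm (X t \<omega> - XN t \<omega>))\<^sup>2) \<le> Q * (1 + E) * ?r"
      using \<open>0 \<le> Q\<close> \<open>0 \<le> E\<close> unfolding mean_sq_def by (intro integral_real_bounded) auto
    then have "sqrt (expectation (\<lambda>\<omega>. (norm (X t \<omega> - XN t \<omega>))\<^sup>2)) \<le>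
        sqrt Q * sqrt (1 + E) * sqrt ?r"
      by (simp add: real_sqrt_mult[symmetric])
    also have "sqrt ?r = lam N powr (- \<mu> / 2)"
      using lam_pos[of N] by (simp add: powr_half_sqrt[symmetric] powr_powr)
    also have "sqrt Q * sqrt (1 + E) * lam N powr (- \<mu> / 2) \<le>
        sqrt Q * (1 + sqrt E) * lam N powr (- \<mu> / 2)"
      using sqrt_add_le_add_sqrt[of 1 E] \<open>0 \<le> E\<close> \<open>0 \<le> Q\<close>
      by (intro mult_right_mono mult_left_mono) auto
    finally show "sqrt (\<integral>\<omega>. (norm (X t \<omega> - XN t \<omega>))\<^sup>2 \<partial>M)
      \<le> sqrt Q * (1 + sqrt (\<integral>\<omega>. Vnorm_sq e lam (2*H + \<beta> - 1) (\<xi> \<omega>) \<partial>M))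
          * lam N powr (- (2*H + \<beta> - 1) / 2)"
      unfolding E_def \<mu>_def .
  qed
qed

end
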